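(* Let $f\in\mathbb{K}[x_1,\ldots,x_n]$ be a concise polynomial and let $\ell=\dim_{\mathbb{K}}\operatorname{Ap}(f)$. Then the following conditions are equivalent: (1) $f$ has maximal growth of powers, i.e. $\dim_{\mathbb{K}}\operatorname{Ap}(f^d)=\binom{\ell+d-1}{d}$ for every $d\geq1$; (2) the total gradient map $$\operatorname{totalGrad}(f)=\left(\frac{\partial f}{\partial\mathbf{x}^{\mathbf{a}_1}},\ldots,\frac{\partial f}{\partial\mathbf{x}^{\mathbf{a}_{\ell-1}}}\right)\colon\mathbb{A}^n\dashrightarrow\mathbb{A}^{\ell-1}$$ is dominant, where the set $\left\{\frac{\partial f}{\partial\mathbf{x}^{\mathbf{a}_i}}\right\}_i\cup\{1\}$ forms a basis of the space of all partials of $f$; (3) the partials of $f$ are homogeneously algebraically independent; (4) $f$ is an encompassing polynomial. Moreover, if these conditions hold, then $\ell=n+1$ and the total gradient map $\operatorname{totalGrad}(f)$ is, up to coordinate changes, the usual gradient map $$\operatorname{grad}(f)=\left(\frac{\partial f}{\partial x_1},\ldots,\frac{\partial f}{\partial x_n}\right)\colon\mathbb{A}^n\dashrightarrow\mathbb{A}^n.$$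
   Context: $\mathbb{K}$ is an algebraically closed field of characteristic zero. $\mathcal{D}=\mathbb{K}[\alpha_1,\ldots,\alpha_n]$ acts on $\mathbb{K}[x_1,\ldots,x_n]$ by letting $\alpha_i$ act as $\partial/\partial x_i$ (written $\sigma\circ f$). $\operatorname{Ann}(f)=\{\sigma\in\mathcal{D}:\sigma\circ f=0\}$ and $\operatorname{Ap}(f)=\mathcal{D}/\operatorname{Ann}(f)$. The space of all partials of $f$ is $\mathcal{D}\circ f$ (including $f$ itself), which has dimension $\ell$. For a multi-index $\mathbf{a}\in\mathbb{Z}_{\geq0}^n$ (possibly $0$), $\frac{\partial f}{\partial\mathbf{x}^{\mathbf{a}}}=(\alpha_1^{a_1}\cdots\alpha_n^{a_n})\circ f$. The polynomial $f$ is concise if $\operatorname{Ann}(f)$ contains no nonzero element of degree $\leq1$. For every polynomial $f$ and every $d\geq1$ one has $\dim_{\mathbb{K}}\operatorname{Ap}(f^d)\leq\binom{\ell+d-1}{d}$. $f$ is encompassing if no nonzero $g\in\mathcal{D}\circ f$ satisfies $g_{\leq1}=0$, where $g_{\leq1}$ is the part of $g$ of degree $\leq1$. A finite-dimensional subspace $V\subseteq\mathbb{K}[x_1,\ldots,x_n]$ is homogeneously algebraically independent if for any (equivalently, some) basis $v_1,\ldots,v_k$ of $V$ there is no nonzero homogeneous polynomial $p\in\mathbb{K}[t_1,\ldots,t_k]$ with $p(v_1,\ldots,v_k)=0$; condition (3) refers to $V=\mathcal{D}\circ f$.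
   Formalization: The last clause is corrected: for f = x, totalGrad(f) = (x) is dominant but grad(f) = (1) is constant, so no coordinate change of A^n relates them; what is stated is (1, totalGrad(f)) = M·(f, grad(f)) for an invertible (n+1)×(n+1) matrix M. *)

theory Defs
  imports
    "HOL-Analysis.Analysis"
    "HOL-Library.Poly_Mapping"
    "HOL-Algebra.Algebraic_Closure_Type"
begin

section \<open>Multivariate polynomials\<close>

text \<open>
  A polynomial in variables indexed by \<open>'v\<close> is a finitely supported function from monomials
  (finitely supported exponent vectors) to coefficients; multiplication is convolution.
  The ring \<open>K[x\<^sub>1,\<dots>,x\<^sub>n]\<close> is the case where \<open>'v\<close> is a finite type \<open>'n\<close> with \<open>n = CARD('n)\<close>.
  The operator ring \<open>K[\<alpha>\<^sub>1,\<dots>,\<alpha>\<^sub>n]\<close> is the same type, acting through \<open>act\<close> below.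
\<close>

type_synonym 'v monom = "'v \<Rightarrow>\<^sub>0 nat"
type_synonym ('v, 'k) mpoly = "('v \<Rightarrow>\<^sub>0 nat) \<Rightarrow>\<^sub>0 'k"

abbreviation lookup :: "('a \<Rightarrow>\<^sub>0 'b::zero) \<Rightarrow> 'a \<Rightarrow> 'b" where
  "lookup \<equiv> Poly_Mapping.lookup"

abbreviation keys :: "('a \<Rightarrow>\<^sub>0 'b::zero) \<Rightarrow> 'a set" where
  "keys \<equiv> Poly_Mapping.keys"

definition const :: "'k \<Rightarrow> ('v, 'k::zero) mpoly" where
  "const c = Poly_Mapping.single 0 c"

definition scale :: "'k \<Rightarrow> ('v, 'k) mpoly \<Rightarrow> ('v, 'k::comm_ring_1) mpoly" where
  "scale c p = const c * p"

global_interpretation mp: vector_space "scale :: 'k::field \<Rightarrow> ('v, 'k) mpoly \<Rightarrow> _"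
proof
  fix a b :: 'k and x y :: "('v, 'k) mpoly"
  show "scale a (x + y) = scale a x + scale a y"
    by (simp add: scale_def algebra_simps)
  show "scale (a + b) x = scale a x + scale b x"
    by (simp add: scale_def const_def single_add algebra_simps)
  show "scale a (scale b x) = scale (a * b) x"
    by (simp add: scale_def const_def mult_single flip: mult.assoc)
  show "scale 1 x = x"
    by (simp add: scale_def const_def)
qed

definition mdeg :: "'v monom \<Rightarrow> nat" where
  "mdeg m = (\<Sum>v\<in>keys m. lookup m v)"

text \<open>The degree of \<open>0\<close> is taken to be \<open>0\<close>.\<close>

definition total_degree :: "('v, 'k::zero) mpoly \<Rightarrow> nat" where
  "total_degree p = Max (insert 0 (mdeg ` keys p))"

definition deg_le_part :: "nat \<Rightarrow> ('v, 'k::comm_monoid_add) mpoly \<Rightarrow> ('v, 'k) mpoly" where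
  "deg_le_part d p = (\<Sum>m\<in>{m \<in> keys p. mdeg m \<le> d}. Poly_Mapping.single m (lookup p m))"

definition homogeneous :: "('v, 'k::zero) mpoly \<Rightarrow> bool" where
  "homogeneous p \<longleftrightarrow> (\<exists>d. \<forall>m\<in>keys p. mdeg m = d)"

definition vars :: "('v, 'k::zero) mpoly \<Rightarrow> 'v set" where
  "vars p = (\<Union>m\<in>keys p. keys m)"

text \<open>
  Evaluation of \<open>p\<close> at a family \<open>g\<close> of elements of a commutative algebra whose structure map is
  \<open>emb\<close>; it is used for points (\<open>emb = id\<close>) and for substituting polynomials (\<open>emb = const\<close>).
\<close>

definition eval_in :: "('k \<Rightarrow> 'a) \<Rightarrow> ('v \<Rightarrow> 'a) \<Rightarrow> ('v, 'k::zero) mpoly \<Rightarrow> 'a::comm_semiring_1" where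
  "eval_in emb g p = (\<Sum>m\<in>keys p. emb (lookup p m) * (\<Prod>v\<in>keys m. g v ^ lookup m v))"

abbreviation eval_at :: "('v \<Rightarrow> 'k) \<Rightarrow> ('v, 'k::comm_semiring_1) mpoly \<Rightarrow> 'k" where
  "eval_at \<equiv> eval_in id"

abbreviation subst_poly ::
  "('w \<Rightarrow> ('v, 'k) mpoly) \<Rightarrow> ('w, 'k) mpoly \<Rightarrow> ('v, 'k::comm_semiring_1) mpoly" where
  "subst_poly \<equiv> eval_in const"


section \<open>Differential operators and partials\<close>

text \<open>In \<open>pd\<close> the truncated subtraction is harmless: if \<open>i\<close> does not occur in \<open>m\<close>, then the
  coefficient vanishes.\<close>

definition pd :: "'v \<Rightarrow> ('v, 'k::comm_ring_1) mpoly \<Rightarrow> ('v, 'k) mpoly" where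
  "pd i p = (\<Sum>m\<in>keys p.
     Poly_Mapping.single (m - Poly_Mapping.single i 1) (of_nat (lookup m i) * lookup p m))"

text \<open>The folded operators commute (\<open>comp_fun_commute_pd_pow\<close>), so the order is irrelevant.\<close>

definition pdiff :: "'n monom \<Rightarrow> ('n::finite, 'k::comm_ring_1) mpoly \<Rightarrow> ('n, 'k) mpoly" where
  "pdiff a p = Finite_Set.fold (\<lambda>i. pd i ^^ lookup a i) p UNIV"

definition act :: "('n, 'k) mpoly \<Rightarrow> ('n::finite, 'k::comm_ring_1) mpoly \<Rightarrow> ('n, 'k) mpoly" where
  "act \<sigma> f = (\<Sum>a\<in>keys \<sigma>. scale (lookup \<sigma> a) (pdiff a f))"

lemma lookup_pd:
  "lookup (pd i p) m = of_nat (Suc (lookup m i)) * lookup p (m + Poly_Mapping.single i 1)"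
proof -
  let ?e = "Poly_Mapping.single i (1::nat)"
  have eq: "lookup (Poly_Mapping.single (k - ?e) (of_nat (lookup k i) * lookup p k)) m
      = (if k = m + ?e then of_nat (Suc (lookup m i)) * lookup p (m + ?e) else 0)" for k
  proof (cases "k = m + ?e")
    case True
    then show ?thesis by (simp add: lookup_single lookup_add)
  next
    case False
    show ?thesis
    proof (cases "lookup k i = 0")
      case True
      then show ?thesis using False by simp
    next
      case nz: False
      have "k = (k - ?e) + ?e"
        using nz by (intro poly_mapping_eqI) (auto simp: lookup_add lookup_minus lookup_single when_def)
      then have "k - ?e \<noteq> m" using False by metis
      then show ?thesis using False by (simp add: lookup_single)
    qed
  qed
  show ?thesis
    unfolding pd_def lookup_sum eq
    by (simp add: in_keys_iff)
qed

lemma pd_commute: "pd i (pd j p) = pd j (pd i p)"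
  by (intro poly_mapping_eqI)
     (auto simp: lookup_pd lookup_add lookup_single ac_simps when_def)

lemma pd_pow_commute: "(pd i ^^ a) ((pd j ^^ b) p) = (pd j ^^ b) ((pd i ^^ a) p)"
proof -
  have 1: "pd i ((pd j ^^ b) p) = (pd j ^^ b) (pd i p)" for p
    by (induction b) (auto simp: pd_commute[of i j])
  show ?thesis
    by (induction a) (auto simp: 1)
qed

lemma comp_fun_commute_pd_pow: "comp_fun_commute (\<lambda>i. pd i ^^ lookup a i)"
  by unfold_locales (auto simp: fun_eq_iff pd_pow_commute)

definition partials :: "('n::finite, 'k::comm_ring_1) mpoly \<Rightarrow> ('n, 'k) mpoly set" where
  "partials f = range (\<lambda>\<sigma>. act \<sigma> f)"

definition Ann :: "('n::finite, 'k::comm_ring_1) mpoly \<Rightarrow> ('n, 'k) mpoly set" where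
  "Ann f = {\<sigma>. act \<sigma> f = 0}"

definition Ap :: "('n::finite, 'k::field) mpoly \<Rightarrow> ('n, 'k) mpoly set ring" where
  "Ap f = ring_of_type_algebra Quot Ann f"

text \<open>The dimension over \<open>K\<close>, where \<open>K\<close> is identified with the set of classes of constants.\<close>

definition dim_Ap :: "('n::finite, 'k::field) mpoly \<Rightarrow> nat" where
  "dim_Ap f = ring.dim (Ap f)
     (range (\<lambda>c. Ann f +>\<^bsub>ring_of_type_algebra\<^esub> const c)) (carrier (Ap f))"

definition concise :: "('n::finite, 'k::field) mpoly \<Rightarrow> bool" where
  "concise f \<longleftrightarrow> \<not> (\<exists>\<sigma>\<in>Ann f. \<sigma> \<noteq> 0 \<and> total_degree \<sigma> \<le> 1)"


section \<open>The four conditions\<close>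

definition maximal_growth :: "('n::finite, 'k::field) mpoly \<Rightarrow> bool" where
  "maximal_growth f \<longleftrightarrow> (\<forall>d\<ge>1. dim_Ap (f ^ d) = (dim_Ap f + d - 1) choose d)"

definition is_basis :: "('v, 'k::field) mpoly list \<Rightarrow> ('v, 'k) mpoly set \<Rightarrow> bool" where
  "is_basis vs V \<longleftrightarrow> distinct vs \<and> mp.independent (set vs) \<and> mp.span (set vs) = V"

text \<open>
  \<open>as\<close> lists the multi-indices \<open>a\<^sub>1, \<dots>, a\<^sub>\<ell>\<^sub>-\<^sub>1\<close> of a total gradient map of \<open>f\<close>.
\<close>

definition total_grad_indices :: "('n::finite, 'k::field) mpoly \<Rightarrow> 'n monom list \<Rightarrow> bool" where
  "total_grad_indices f as \<longleftrightarrow>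
     length as = dim_Ap f - 1 \<and> is_basis (1 # map (\<lambda>a. pdiff a f) as) (partials f)"

text \<open>
  \<open>\<A>\<^sup>n\<close> is the function space \<open>'n \<Rightarrow> 'k\<close>, and \<open>\<A>\<^sup>m\<close> for a number \<open>m\<close> is the set \<open>aff m\<close> of
  functions on \<open>{..<m}\<close>, extended by \<^const>\<open>undefined\<close>.
\<close>

definition aff :: "nat \<Rightarrow> (nat \<Rightarrow> 'k) set" where
  "aff m = {..<m} \<rightarrow>\<^sub>E UNIV"

definition total_grad ::
  "('n::finite, 'k::field) mpoly \<Rightarrow> 'n monom list \<Rightarrow> ('n \<Rightarrow> 'k) \<Rightarrow> (nat \<Rightarrow> 'k)" where
  "total_grad f as = (\<lambda>x. \<lambda>i\<in>{..<length as}. eval_at x (pdiff (as ! i) f))"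

definition grad :: "('n::finite, 'k::field) mpoly \<Rightarrow> ('n \<Rightarrow> 'k) \<Rightarrow> ('n \<Rightarrow> 'k)" where
  "grad f = (\<lambda>x i. eval_at x (pd i f))"

definition zariski_closed :: "nat \<Rightarrow> (nat \<Rightarrow> 'k::field) set \<Rightarrow> bool" where
  "zariski_closed m Z \<longleftrightarrow>
     (\<exists>S. (\<forall>p\<in>S. vars p \<subseteq> {..<m}) \<and> Z = {y \<in> aff m. \<forall>p\<in>S. eval_at y p = 0})"

definition zariski_closure :: "nat \<Rightarrow> (nat \<Rightarrow> 'k::field) set \<Rightarrow> (nat \<Rightarrow> 'k) set" where
  "zariski_closure m A = \<Inter> {Z. zariski_closed m Z \<and> A \<subseteq> Z}"

definition dominant :: "nat \<Rightarrow> ('a \<Rightarrow> nat \<Rightarrow> 'k::field) \<Rightarrow> bool" where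
  "dominant m \<phi> \<longleftrightarrow> range \<phi> \<subseteq> aff m \<and> zariski_closure m (range \<phi>) = aff m"

definition hom_alg_independent :: "('v, 'k::field) mpoly set \<Rightarrow> bool" where
  "hom_alg_independent V \<longleftrightarrow>
     (\<exists>vs. is_basis vs V) \<and>
     (\<forall>vs. is_basis vs V \<longrightarrow>
       \<not> (\<exists>p :: (nat, 'k) mpoly. p \<noteq> 0 \<and> homogeneous p \<and> vars p \<subseteq> {..<length vs} \<and>
            subst_poly (\<lambda>i. vs ! i) p = 0))"

text \<open>
  The target of the (total) gradient map is compactified to \<open>\<P>\<^sup>n\<close>, and the coordinate changes are
  linear changes of homogeneous coordinates. The homogenizing coordinate of the total gradient
  map is \<open>1\<close>, that of the gradient map is \<open>f\<close>: so \<open>[1 : totalGrad f]\<close> and \<open>[f : grad f]\<close> are compared.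
  No change of coordinates of \<open>\<A>\<^sup>n\<close> itself can identify \<open>totalGrad f\<close> with \<open>grad f\<close>: if \<open>f\<close> is concise
  and \<open>\<ell> = n + 1\<close>, then \<open>f, \<partial>f/\<partial>x\<^sub>1, \<dots>, \<partial>f/\<partial>x\<^sub>n\<close> is a basis of the space of partials, and by
  degrees \<open>1\<close> is a linear combination of the \<open>\<partial>f/\<partial>x\<^sub>i\<close>, so that \<open>grad f\<close> is not dominant
  (for \<open>f = x\<close> in one variable, \<open>totalGrad f = x\<close> and \<open>grad f = 1\<close>).
\<close>

definition equal_up_to_coord_change :: "('a \<Rightarrow> 'k::field ^ 'm) \<Rightarrow> ('a \<Rightarrow> 'k ^ 'm) \<Rightarrow> bool" where
  "equal_up_to_coord_change \<phi> \<psi> \<longleftrightarrow> (\<exists>M :: 'k ^ 'm ^ 'm. invertible M \<and> (\<forall>x. \<phi> x = M *v \<psi> x))"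

text \<open>The point \<open>(c, y)\<close> of \<open>\<A>\<^sup>n\<^sup>+\<^sup>1\<close>, whose coordinates are indexed by \<open>'n option\<close>.\<close>

definition with_coord0 :: "'k \<Rightarrow> ('n::finite \<Rightarrow> 'k) \<Rightarrow> 'k ^ 'n option" where
  "with_coord0 c y = (\<chi> j. case j of None \<Rightarrow> c | Some i \<Rightarrow> y i)"

definition encompassing :: "('n::finite, 'k::field) mpoly \<Rightarrow> bool" where
  "encompassing f \<longleftrightarrow> \<not> (\<exists>g\<in>partials f. g \<noteq> 0 \<and> deg_le_part 1 g = 0)"

end

theory Submission
  imports Defs
begin

text \<open>
  Let \<open>V\<close> be the space of partials of \<open>f\<close>, of dimension \<open>\<ell>\<close>, and \<open>V\<^sup>d\<close> the span of the products of
  \<open>d\<close> elements of \<open>V\<close>. Every condition is compared with the basis-free statement that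
  \<open>dim V\<^sup>d\<close> is the number \<open>(\<ell> + d - 1) choose d\<close> of monomials of degree \<open>d\<close> for all \<open>d\<close>. For (3)
  this is immediate, and for (2) it is dehomogenization, as \<open>1 \<in> V\<close> and the field is infinite. Since
  \<open>f\<close> is concise, \<open>f\<close> and its first derivatives are \<open>n + 1\<close> independent elements of \<open>V\<close>.

  If \<open>dim V\<^sup>d\<close> is maximal for all \<open>d\<close>, then \<open>\<ell> \<le> n + 1\<close>, because \<open>dim V\<^sup>d\<close> is at most the
  dimension of the polynomials of degree at most \<open>d deg f\<close>; so \<open>V\<close> is spanned by \<open>f\<close> and its
  first derivatives. Then the operators of degree at most \<open>1\<close> already produce all partials, so that a
  partial without terms of degree at most \<open>1\<close> has no terms at all: \<open>f\<close> is encompassing. Conversely, if \<open>f\<close>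
  is encompassing, then truncation embeds \<open>V\<close> into the polynomials of degree at most \<open>1\<close>; hence
  \<open>\<ell> = n + 1\<close>, and \<open>V\<close> contains \<open>1\<close> and polynomials \<open>v\<^sub>i = x\<^sub>i + \<dots>\<close> with higher order remainder,
  which are algebraically independent by their lowest terms.

  Finally, the partials of \<open>f\<^sup>d\<close> always lie in \<open>V\<^sup>d\<close>. If \<open>V\<close> is spanned by \<open>f\<close> and its first derivatives,
  they fill \<open>V\<^sup>d\<close>: by the Leibniz rule \<open>f\<^sup>d\<^sup>-\<^sup>k\<^sup>-\<^sup>1 (\<partial>\<^sub>i f) g\<close> with \<open>g \<in> V\<^sup>k\<close> is a multiple of
  \<open>\<partial>\<^sub>i (f\<^sup>d\<^sup>-\<^sup>k g) - f\<^sup>d\<^sup>-\<^sup>k \<partial>\<^sub>i g\<close>, and one concludes by induction on \<open>k\<close>.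
\<close>

unbundle no fps_syntax

section \<open>Differentiation\<close>

lemma lookup_scale [simp]: "lookup (scale c p) m = c * lookup p m"
  unfolding scale_def const_def mult_map_scale_conv_mult[symmetric]
  by (simp add: map.rep_eq when_def)

lemma scale_single [simp]: "scale c (Poly_Mapping.single m a) = Poly_Mapping.single m (c * a)"
  by (simp add: scale_def const_def mult_single)

lemma scale_mult_left: "scale c p * q = scale c (p * q)"
  by (simp add: scale_def mult.assoc)

lemma scale_mult_right: "p * scale c q = scale c (p * q)"
  by (simp add: scale_def mult.left_commute)

lemma mpoly_sum_single:
  assumes "finite A" "keys p \<subseteq> A"
  shows "p = (\<Sum>m\<in>A. Poly_Mapping.single m (lookup p m))"
proof (rule poly_mapping_eqI)
  fix k
  have "lookup (\<Sum>m\<in>A. Poly_Mapping.single m (lookup p m)) k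
      = (\<Sum>m\<in>A. if m = k then lookup p k else 0)"
    by (auto simp: lookup_sum lookup_single when_def intro!: sum.cong)
  also have "\<dots> = lookup p k"
    using assms by (auto simp: not_in_keys_iff_lookup_eq_zero)
  finally show "lookup p k = lookup (\<Sum>m\<in>A. Poly_Mapping.single m (lookup p m)) k" by simp
qed

text \<open>Additive identities need only be checked on single terms.\<close>

lemma mpoly_induct [case_names single add zero]:
  fixes p :: "'a \<Rightarrow>\<^sub>0 'b::comm_monoid_add"
  assumes "\<And>m c. P (Poly_Mapping.single m c)" "\<And>p q. P p \<Longrightarrow> P q \<Longrightarrow> P (p + q)" "P 0"
  shows "P p"
proof -
  have "P (\<Sum>m\<in>A. Poly_Mapping.single m (lookup p m))" if "finite A" for A
    using that by (induction A) (auto intro: assms)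
  from this[of "keys p"] show ?thesis
    using mpoly_sum_single[of "keys p" p] by simp
qed

global_interpretation mpp: vector_space_pair
  "scale :: 'k::field \<Rightarrow> ('v, 'k) mpoly \<Rightarrow> _" "scale :: 'k::field \<Rightarrow> ('w, 'k) mpoly \<Rightarrow> _"
  by unfold_locales

abbreviation mp_linear :: "(('v, 'k::field) mpoly \<Rightarrow> ('w, 'k) mpoly) \<Rightarrow> bool" where
  "mp_linear \<equiv> Vector_Spaces.linear scale scale"

lemma mp_linearI:
  assumes "\<And>p q. T (p + q) = T p + T q" "\<And>c p. T (scale c p) = scale c (T p)"
  shows "mp_linear T"
  unfolding Vector_Spaces.linear_iff using assms by (simp add: mp.vector_space_axioms)

lemma pd_linear: "mp_linear (pd i)"
  by (rule mp_linearI; rule poly_mapping_eqI) (auto simp: lookup_pd lookup_add algebra_simps)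

lemmas pd_add = mpp.linear_add[OF pd_linear]
lemmas pd_scale = mpp.linear_scale[OF pd_linear]
lemmas pd_0 [simp] = mpp.linear_0[OF pd_linear]

lemma pd_single:
  "pd i (Poly_Mapping.single m c) = Poly_Mapping.single (m - Poly_Mapping.single i 1) (of_nat (lookup m i) * c)"
  by (cases "c = 0") (simp_all add: pd_def)

text \<open>Subtraction of exponents is truncated, so it commutes with adding \<open>m'\<close> in
  general only if the variable occurs in \<open>m\<close>; otherwise the derivative of the term has
  coefficient zero.\<close>

lemma monom_add_diff_single:
  assumes "lookup m i \<noteq> 0"
  shows "m + m' - Poly_Mapping.single i 1 = (m - Poly_Mapping.single i 1) + (m' :: 'v monom)"
  using assms by (intro poly_mapping_eqI) (auto simp: lookup_add lookup_minus lookup_single when_def)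

lemma pd_mult: "pd i (p * q) = pd i p * q + p * pd i (q :: ('v, 'k::field) mpoly)"
proof (induction p rule: mpoly_induct)
  case (single m c)
  show ?case
  proof (induction q rule: mpoly_induct)
    case (single m' c')
    let ?s = "Poly_Mapping.single i (1::nat)"
    have 1: "Poly_Mapping.single (m + m' - ?s) (of_nat (lookup m i) * c * c')
        = Poly_Mapping.single ((m - ?s) + m') (of_nat (lookup m i) * c * c')"
      by (cases "lookup m i = 0") (simp_all add: monom_add_diff_single[simplified])
    have 2: "Poly_Mapping.single (m + m' - ?s) (c * (of_nat (lookup m' i) * c'))
        = Poly_Mapping.single (m + (m' - ?s)) (c * (of_nat (lookup m' i) * c'))"
      by (cases "lookup m' i = 0") (simp_all add: monom_add_diff_single[simplified] add.commute[of m])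
    show ?case
      unfolding mult_single pd_single 1[symmetric] 2[symmetric] single_add[symmetric]
      by (simp add: lookup_add algebra_simps)
  qed (simp_all add: pd_add algebra_simps)
qed (simp_all add: pd_add algebra_simps)

lemma pd_power_Suc: "pd i (p ^ Suc n) = scale (of_nat (Suc n)) (p ^ n * pd i (p :: ('v, 'k::field) mpoly))"
proof (induction n)
  case (Suc n)
  have "pd i (p ^ Suc (Suc n)) = p ^ Suc n * pd i p + scale (of_nat (Suc n)) (p ^ Suc n * pd i p)"
    unfolding power_Suc[of p "Suc n"] pd_mult Suc scale_mult_right by (simp add: mult.commute mult.left_commute)
  also have "\<dots> = scale (of_nat (Suc (Suc n))) (p ^ Suc n * pd i p)"
    unfolding of_nat_Suc[of "Suc n"] mp.scale_left_distrib by simp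
  finally show ?case .
qed simp

section \<open>Iterated derivatives and the action of operators\<close>

lemma pdiff_zero [simp]: "pdiff 0 p = p"
proof -
  interpret comp_fun_commute "\<lambda>i. pd i ^^ lookup 0 i" by (rule comp_fun_commute_pd_pow)
  have "Finite_Set.fold (\<lambda>i. pd i ^^ lookup 0 i) p A = p" if "finite A" for A
    using that
  proof (induction A)
    case (insert j A)
    then show ?case unfolding fold_insert[OF insert(1,2)] by (simp add: id_def)
  qed simp
  then show ?thesis by (simp add: pdiff_def)
qed

text \<open>In a fold of commuting operators the one for \<open>i\<close> may be taken last, and the
  others do not see the change of exponent. With \<open>monom_induct\<close> this recursion replaces
  the fold.\<close>

lemma pdiff_add_single: "pdiff (a + Poly_Mapping.single i 1) p = pd i (pdiff a p)"
proof -
  let ?a = "a + Poly_Mapping.single i (1::nat)"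
  let ?F = "\<lambda>a. Finite_Set.fold (\<lambda>i. pd i ^^ lookup a i)"
  have eq: "?F ?a p A = ?F a p A" if "i \<notin> A" for A
    using finite[of A] that
  proof (induction A)
    case (insert j A)
    interpret c: comp_fun_commute "\<lambda>i. pd i ^^ lookup a i" by (rule comp_fun_commute_pd_pow)
    interpret d: comp_fun_commute "\<lambda>i. pd i ^^ lookup ?a i" by (rule comp_fun_commute_pd_pow)
    from insert show ?case
      unfolding c.fold_insert[OF insert(1,2)] d.fold_insert[OF insert(1,2)]
      by (auto simp: lookup_add lookup_single when_def)
  qed simp
  interpret c: comp_fun_commute "\<lambda>i. pd i ^^ lookup a i" by (rule comp_fun_commute_pd_pow)
  interpret d: comp_fun_commute "\<lambda>i. pd i ^^ lookup ?a i" by (rule comp_fun_commute_pd_pow)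
  have "?F ?a p (insert i (UNIV - {i})) = (pd i ^^ lookup ?a i) (?F ?a p (UNIV - {i}))"
    by (rule d.fold_insert) auto
  also have "\<dots> = pd i ((pd i ^^ lookup a i) (?F a p (UNIV - {i})))"
    by (subst eq) (simp_all add: lookup_add)
  also have "(pd i ^^ lookup a i) (?F a p (UNIV - {i})) = ?F a p (insert i (UNIV - {i}))"
    by (rule c.fold_insert[symmetric]) auto
  finally show ?thesis by (simp add: pdiff_def insert_absorb)
qed

lemma monom_induct [case_names zero add]:
  fixes P :: "'v monom \<Rightarrow> bool"
  assumes "P 0" "\<And>a i. P a \<Longrightarrow> P (a + Poly_Mapping.single i 1)"
  shows "P a"
proof -
  have step: "P (a + Poly_Mapping.single i n)" if "P a" for a i n
  proof (induction n)
    case (Suc n)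
    from assms(2)[OF this, of i] show ?case
      by (simp add: add.assoc flip: single_add)
  qed (simp add: that)
  have "P (\<Sum>m\<in>A. Poly_Mapping.single m (lookup a m))" if "finite A" for A
    using that
  proof (induction A)
    case (insert x A)
    then show ?case using step[of "\<Sum>m\<in>A. Poly_Mapping.single m (lookup a m)" x "lookup a x"]
      by (simp add: add.commute)
  qed (simp add: assms)
  moreover have "a = (\<Sum>m\<in>keys a. Poly_Mapping.single m (lookup a m))"
    by (rule poly_mapping_eqI)
      (auto simp: lookup_sum lookup_single when_def sum.delta' not_in_keys_iff_lookup_eq_zero)
  ultimately show ?thesis by (metis finite_keys)
qed

lemma pdiff_linear: "mp_linear (pdiff a)"
proof (induction a rule: monom_induct)
  case zero
  show ?case by (rule mp_linearI) auto
next
  case (add a i)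
  show ?case
    by (rule mp_linearI)
      (simp_all only: pdiff_add_single pd_add pd_scale mpp.linear_add[OF add] mpp.linear_scale[OF add])
qed

lemma pdiff_pdiff: "pdiff a (pdiff b p) = pdiff (a + b) (p :: ('n::finite, 'k::field) mpoly)"
proof (induction a rule: monom_induct)
  case (add a i)
  have "a + Poly_Mapping.single i 1 + b = (a + b) + Poly_Mapping.single i 1" by (simp add: ac_simps)
  with add show ?case by (simp only: pdiff_add_single)
qed simp

text \<open>The factor is (m + a)! / m! with factorials of multi-indices; only its positivity and
  its independence of \<open>p\<close> matter.\<close>

lemma lookup_pdiff:
  "\<exists>c>0. \<forall>p :: ('n::finite, 'k::field) mpoly. lookup (pdiff a p) m = of_nat c * lookup p (m + a)"
proof (induction a arbitrary: m rule: monom_induct)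
  case zero
  show ?case by (rule exI[of _ 1]) simp
next
  case (add a i)
  from add[of "m + Poly_Mapping.single i 1"] obtain c where
    c: "c > 0" "\<forall>p :: ('n, 'k) mpoly. lookup (pdiff a p) (m + Poly_Mapping.single i 1)
        = of_nat c * lookup p (m + Poly_Mapping.single i 1 + a)" by blast
  show ?case
    by (rule exI[of _ "Suc (lookup m i) * c"])
      (use c in \<open>auto simp: pdiff_add_single[simplified] lookup_pd ac_simps distrib_left distrib_right\<close>)
qed

lemma act_superset:
  assumes "finite A" "keys s \<subseteq> A"
  shows "act s f = (\<Sum>a\<in>A. scale (lookup s a) (pdiff a (f :: ('n::finite, 'k::field) mpoly)))"
  unfolding act_def
  by (rule sum.mono_neutral_left) (use assms in \<open>auto simp: in_keys_iff\<close>)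

lemma act_single [simp]: "act (Poly_Mapping.single a c) f = scale c (pdiff a (f :: ('n::finite, 'k::field) mpoly))"
  by (cases "c = 0") (simp_all add: act_def)

lemma act_zero [simp]: "act 0 f = 0" "act s 0 = (0 :: ('n::finite, 'k::field) mpoly)"
  by (simp_all add: act_def mpp.linear_0[OF pdiff_linear])

lemma act_add: "act (s + t) f = act s f + act t (f :: ('n::finite, 'k::field) mpoly)"
proof -
  let ?A = "keys s \<union> keys t"
  have *: "keys (s + t) \<subseteq> ?A" by (rule keys_add)
  show ?thesis
    unfolding act_superset[of ?A "s + t", OF _ *, simplified]
      act_superset[of ?A s, simplified] act_superset[of ?A t, simplified]
    by (simp add: lookup_add mp.scale_left_distrib sum.distrib)
qed

lemma act_linear: "mp_linear (act s :: ('n::finite, 'k::field) mpoly \<Rightarrow> _)"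
  by (rule mp_linearI)
    (simp_all add: act_def mpp.linear_add[OF pdiff_linear] mpp.linear_scale[OF pdiff_linear]
      mp.scale_right_distrib sum.distrib mp.scale_sum_right mult.commute)

lemma act_mult: "act (s * t) f = act s (act t (f :: ('n::finite, 'k::field) mpoly))"
proof (induction s rule: mpoly_induct)
  case (single m c)
  show ?case
    by (induction t rule: mpoly_induct)
      (simp_all add: mult_single pdiff_pdiff act_add algebra_simps mpp.linear_add[OF pdiff_linear]
        mpp.linear_scale[OF pdiff_linear] mp.scale_right_distrib mpp.linear_0[OF pdiff_linear])
qed (simp_all add: act_add algebra_simps)

lemma act_scale: "act (scale c s) f = scale c (act s (f :: ('n::finite, 'k::field) mpoly))"
  unfolding scale_def[of c s] const_def act_mult by simp

lemma act_linear_left: "mp_linear (\<lambda>s. act s (f :: ('n::finite, 'k::field) mpoly))"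
  by (rule mp_linearI) (simp_all add: act_add act_scale)

lemma act_commute: "act s (act t f) = act t (act s (f :: ('n::finite, 'k::field) mpoly))"
  by (metis act_mult mult.commute)

section \<open>The space of partials\<close>

lemma subspace_partials: "mp.subspace (partials (f :: ('n::finite, 'k::field) mpoly))"
  unfolding partials_def using mpp.linear_subspace_image[OF act_linear_left mp.subspace_UNIV] .

lemma pdiff_in_partials: "pdiff a f \<in> partials (f :: ('n::finite, 'k::field) mpoly)"
  unfolding partials_def by (rule range_eqI[of _ _ "Poly_Mapping.single a 1"]) simp

lemma self_in_partials: "f \<in> partials (f :: ('n::finite, 'k::field) mpoly)"
  using pdiff_in_partials[of 0 f] by simp

lemma partials_eq_span: "partials f = mp.span (range (\<lambda>a. pdiff a (f :: ('n::finite, 'k::field) mpoly)))"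
proof
  show "mp.span (range (\<lambda>a. pdiff a f)) \<subseteq> partials f"
    by (rule mp.span_minimal) (auto simp: pdiff_in_partials subspace_partials)
  show "partials f \<subseteq> mp.span (range (\<lambda>a. pdiff a f))"
    unfolding partials_def act_def
    by (intro image_subsetI mp.span_sum mp.span_scale mp.span_base rangeI)
qed

lemma pd_in_partials:
  assumes "g \<in> partials (f :: ('n::finite, 'k::field) mpoly)"
  shows "pd i g \<in> partials f"
proof -
  have "pd i p = act (Poly_Mapping.single (Poly_Mapping.single i 1) 1) p" for p :: "('n, 'k) mpoly"
    using pdiff_add_single[of 0 i p] by simp
  then show ?thesis using assms by (auto simp only: partials_def act_mult[symmetric])
qed

text \<open>Every iterated derivative is reached from \<open>f\<close> by first derivatives. This
  serves to bound the space of partials from above.\<close>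

lemma partials_minimal:
  assumes "mp.subspace W" "f \<in> W" "\<And>i g. g \<in> W \<Longrightarrow> pd i g \<in> W"
  shows "partials (f :: ('n::finite, 'k::field) mpoly) \<subseteq> W"
proof -
  have "pdiff a f \<in> W" for a
  proof (induction a rule: monom_induct)
    case (add a i)
    then show ?case using assms(3)[OF add] by (simp add: pdiff_add_single[simplified])
  qed (simp add: assms)
  then show ?thesis
    unfolding partials_eq_span by (intro mp.span_minimal) (auto simp: assms)
qed

text \<open>Up to a positive integer, invertible in characteristic zero, the constant term of
  \<open>pdiff m g\<close> is the coefficient of \<open>g\<close> at \<open>m\<close>.\<close>

lemma mpoly_eq_0_if_pdiff_const_0:
  fixes g :: "('n::finite, 'k::field_char_0) mpoly"
  assumes "\<And>a. lookup (pdiff a g) 0 = 0"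
  shows "g = 0"
proof (rule poly_mapping_eqI)
  fix m
  obtain c where "c > 0" "\<forall>p :: ('n, 'k) mpoly. lookup (pdiff m p) 0 = of_nat c * lookup p (0 + m)"
    using lookup_pdiff by blast
  with assms[of m] show "lookup g m = lookup 0 m" by simp
qed

section \<open>Degrees of monomials\<close>

lemma mdeg_superset: "finite A \<Longrightarrow> keys m \<subseteq> A \<Longrightarrow> mdeg m = (\<Sum>v\<in>A. lookup m v)"
  unfolding mdeg_def by (rule sum.mono_neutral_left) (auto simp: in_keys_iff)

lemma mdeg_add: "mdeg (a + b) = mdeg a + mdeg b"
proof -
  have "keys (a + b) \<subseteq> keys a \<union> keys b" by (rule keys_add)
  then show ?thesis
    using mdeg_superset[of "keys a \<union> keys b"] by (simp add: lookup_add sum.distrib)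
qed

lemma mdeg_single [simp]: "mdeg (Poly_Mapping.single i n) = n"
  by (cases "n = 0") (simp_all add: mdeg_def)

lemma mdeg_zero [simp]: "mdeg 0 = 0"
  by (simp add: mdeg_def)

lemma mdeg_eq_0_iff [simp]: "mdeg m = 0 \<longleftrightarrow> m = 0"
  unfolding mdeg_def by (auto simp: in_keys_iff intro!: poly_mapping_eqI)

lemma monom_cases:
  assumes "keys m \<subseteq> S" "mdeg m = Suc d"
  obtains i m' where "i \<in> S" "m = m' + Poly_Mapping.single i (1::nat)" "keys m' \<subseteq> S" "mdeg m' = d"
proof -
  from assms obtain i where i: "i \<in> keys m"
    by (metis all_not_in_conv keys_eq_empty mdeg_zero nat.distinct(1))
  let ?m' = "m - Poly_Mapping.single i 1"
  have m: "m = ?m' + Poly_Mapping.single i 1"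
    using i by (intro poly_mapping_eqI) (auto simp: lookup_add lookup_minus lookup_single when_def in_keys_iff)
  have "mdeg m = mdeg ?m' + 1" using arg_cong[OF m, of mdeg] by (simp add: mdeg_add)
  moreover have "keys ?m' \<subseteq> S"
  proof
    fix v assume "v \<in> keys ?m'"
    then have "lookup m v \<noteq> 0" by (auto simp: in_keys_iff lookup_minus)
    then show "v \<in> S" using assms(1) by (auto simp: in_keys_iff)
  qed
  ultimately show ?thesis using that[of i ?m'] m i assms by auto
qed

text \<open>Differentiating along a monomial of top degree in \<open>f\<close> leaves a nonzero
  constant.\<close>

lemma one_in_partials:
  fixes f :: "('n::finite, 'k::field_char_0) mpoly"
  assumes "f \<noteq> 0"
  shows "1 \<in> partials f"
proof -
  have "keys f \<noteq> {}" using assms by simp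
  then have "Max (mdeg ` keys f) \<in> mdeg ` keys f" by (intro Max_in) auto
  then obtain a where a: "a \<in> keys f" "mdeg a = Max (mdeg ` keys f)" by force
  have max: "mdeg b \<le> mdeg a" if "b \<in> keys f" for b
    using that by (auto simp: a(2) intro: Max_ge)
  obtain c where c: "c > 0" "\<forall>p :: ('n, 'k) mpoly. lookup (pdiff a p) 0 = of_nat c * lookup p (0 + a)"
    using lookup_pdiff by blast
  define k where "k = of_nat c * lookup f a"
  have k: "k \<noteq> 0" using a(1) c(1) by (auto simp: k_def in_keys_iff)
  have "pdiff a f = Poly_Mapping.single 0 k"
  proof (rule poly_mapping_eqI)
    fix m
    show "lookup (pdiff a f) m = lookup (Poly_Mapping.single 0 k) m"
    proof (cases "m = 0")
      case True
      then show ?thesis using c by (simp add: k_def)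
    next
      case False
      then have "m + a \<notin> keys f"
        using max[of "m + a"] by (auto simp: mdeg_add)
      moreover obtain c where "\<forall>p :: ('n, 'k) mpoly. lookup (pdiff a p) m = of_nat c * lookup p (m + a)"
        using lookup_pdiff by blast
      ultimately show ?thesis using False by (simp add: lookup_single in_keys_iff)
    qed
  qed
  then have "1 = scale (1 / k) (pdiff a f)" using k by simp
  then show ?thesis
    by (metis mp.subspace_scale pdiff_in_partials subspace_partials)
qed

section \<open>The dimension of the apolar algebra\<close>

lemma ideal_Ann: "ideal (Ann (f :: ('n::finite, 'k::field) mpoly)) ring_of_type_algebra"
proof (rule idealI)
  let ?R = "ring_of_type_algebra :: ('n, 'k) mpoly ring"
  show "ring ?R" by (rule ring_from_type_algebra)
  interpret ring ?R by (rule ring_from_type_algebra)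
  have inv: "\<ominus>\<^bsub>?R\<^esub> s = - s" for s
    by (rule minus_equality) (auto simp: ring_of_type_algebra_def)
  show "subgroup (Ann f) (add_monoid ?R)"
    by (rule add.subgroupI)
      (auto simp: Ann_def ring_of_type_algebra_def act_add mpp.linear_neg[OF act_linear_left]
        inv[unfolded ring_of_type_algebra_def] a_inv_def[symmetric] intro!: exI[of _ 0])
qed (auto simp: Ann_def ring_of_type_algebra_def act_mult intro: act_commute[THEN trans])

text \<open>Two operators differ by an annihilator exactly when they act alike on \<open>f\<close>,
  so a class can be handled through the partial that it produces.\<close>

lemma Ann_coset: "Ann f +>\<^bsub>ring_of_type_algebra\<^esub> s = {t. act t f = act s (f :: ('n::finite, 'k::field) mpoly)}"
proof -
  have "t \<in> Ann f +>\<^bsub>ring_of_type_algebra\<^esub> s \<longleftrightarrow> t - s \<in> Ann f" for t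
    unfolding a_r_coset_def' by (auto simp: ring_of_type_algebra_def intro: bexI[of _ "t - s"])
  then show ?thesis
    by (auto simp: Ann_def mpp.linear_diff[OF act_linear_left])
qed

text \<open>Applying operators to \<open>f\<close> identifies the apolar algebra with the space of
  partials. Since \<open>ring.dim\<close> and \<open>mp.dim\<close> belong to different formalisms,
  a basis of the partials is carried over vector by vector.\<close>

lemma dim_Ap_eq:
  fixes f :: "('n::finite, 'k::field_char_0) mpoly"
  assumes f: "f \<noteq> 0" and fin: "finite S" "partials f \<subseteq> mp.span S"
  shows "dim_Ap f = mp.dim (partials f)"
proof -
  define R where "R = (ring_of_type_algebra :: ('n, 'k) mpoly ring)"
  define Q where "Q = Ap f"
  define h where "h = (\<lambda>s. Ann f +>\<^bsub>R\<^esub> s)"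
  have Q_eq: "Q = R Quot Ann f" by (simp add: Q_def R_def Ap_def)
  have id: "ideal (Ann f) R" unfolding R_def by (rule ideal_Ann)
  have hom: "h \<in> ring_hom R Q"
    unfolding Q_eq h_def by (rule ideal.rcos_ring_hom[OF id])
  interpret Q: ring Q unfolding Q_eq by (rule ideal.quotient_is_ring[OF id])
  have h_set: "h s = {t. act t f = act s f}" for s
    unfolding h_def R_def by (rule Ann_coset)
  have h_eq: "h s = h t \<longleftrightarrow> act s f = act t f" for s t
    unfolding h_set by auto
  have h_carr: "h s \<in> carrier Q" for s
    using ring_hom_closed[OF hom, of s] by (simp add: R_def ring_of_type_algebra_def)
  have h_mult: "h s \<otimes>\<^bsub>Q\<^esub> h t = h (s * t)" for s t
    using ring_hom_mult[OF hom, of s t] by (simp add: R_def ring_of_type_algebra_def)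
  have h_add: "h s \<oplus>\<^bsub>Q\<^esub> h t = h (s + t)" for s t
    using ring_hom_add[OF hom, of s t] by (simp add: R_def ring_of_type_algebra_def)
  have h_one: "\<one>\<^bsub>Q\<^esub> = h 1"
    using ring_hom_one[OF hom] by (simp add: R_def ring_of_type_algebra_def)
  have h_zero: "\<zero>\<^bsub>Q\<^esub> = h 0"
    using h_set[of 0] by (simp add: Q_eq FactRing_def Ann_def)
  have carr: "carrier Q = range h"
    by (auto simp: Q_eq FactRing_def A_RCOSETS_def' h_def R_def ring_of_type_algebra_def)
  define K where "K = range (\<lambda>c. h (const c))"
  have K_eq: "K = (\<lambda>c. h (const c)) ` carrier ring_of_type_algebra"
    by (simp add: K_def ring_of_type_algebra_def)
  have "(\<lambda>c. h (const c)) \<in> ring_hom ring_of_type_algebra Q"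
    by (rule ring_hom_memI)
      (auto simp: h_carr h_mult h_add h_one ring_of_type_algebra_def const_def mult_single single_add)
  then have hom': "ring_hom_ring ring_of_type_algebra Q (\<lambda>c. h (const c))"
    by (intro ring_hom_ringI2 Q.ring_axioms ring_from_type_algebra)
  interpret F: field "ring_of_type_algebra :: 'k ring" by (rule field_from_type_algebra)
  have "\<one>\<^bsub>Q\<^esub> \<noteq> \<zero>\<^bsub>Q\<^esub>"
    using f pdiff_zero[of f] act_single[of 0 1 f] by (simp add: h_one h_zero h_eq)
  \<comment> \<open>The image of a field is a field once 1 and 0 differ in the quotient, which holds
    because \<open>f\<close> is nonzero.\<close>
  then have K: "subfield K Q"
    unfolding K_eq by (rule ring_hom_ring.img_is_subfield(2)[OF hom' F.carrier_is_subfield])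
  \<comment> \<open>\<open>Q.dimension\<close> grows by line extensions: a new basis vector
    \<open>act \<beta> f\<close> must add exactly the line through the class of
    \<open>\<beta>\<close>.\<close>
  have dimension: "Q.dimension (card B) K {h s | s. act s f \<in> mp.span B}"
    if "finite B" "mp.independent B" "B \<subseteq> partials f" for B
    using that
  proof (induction B)
    case empty
    have "{h s | s. act s f \<in> mp.span {}} = {h 0}"
      using h_eq[of _ 0] by (auto intro: exI[of _ 0])
    then show ?case using Q.zero_dim[of K] by (simp add: h_zero)
  next
    case (insert b B)
    let ?E = "\<lambda>B. {h s | s. act s f \<in> mp.span B}"
    from insert.prems insert.hyps have b: "b \<notin> mp.span B" "mp.independent B" "B \<subseteq> partials f"
      by (auto simp: mp.independent_insert)
    from insert.prems obtain \<beta> where \<beta>: "b = act \<beta> f" by (auto simp: partials_def)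
    have "h \<beta> \<notin> ?E B" using b(1) by (auto simp: h_eq \<beta>)
    then have "Q.dimension (Suc (card B)) K (Q.line_extension K (h \<beta>) (?E B))"
      by (intro Q.Suc_dim h_carr insert.IH b)
    moreover have "Q.line_extension K (h \<beta>) (?E B) = ?E (insert b B)"
    proof (intro equalityI subsetI)
      fix u assume "u \<in> Q.line_extension K (h \<beta>) (?E B)"
      then obtain c s where u: "u = h (const c * \<beta> + s)" "act s f \<in> mp.span B"
        by (auto simp: Q.line_extension_mem_iff K_def h_mult h_add)
      have "act (const c * \<beta> + s) f - scale c b \<in> mp.span B"
        using u(2) by (simp add: act_add act_scale \<beta> flip: scale_def)
      then show "u \<in> ?E (insert b B)" using u(1) mp.span_breakdown_eq by blast
    next
      fix u assume "u \<in> ?E (insert b B)"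
      then obtain s where s: "u = h s" "act s f \<in> mp.span (insert b B)" by auto
      then obtain c where c: "act s f - scale c b \<in> mp.span B"
        using mp.span_breakdown_eq by blast
      let ?t = "s - scale c \<beta>"
      have "act ?t f \<in> mp.span B"
        using c by (simp add: mpp.linear_diff[OF act_linear_left] act_scale \<beta>)
      moreover have "u = h (const c) \<otimes>\<^bsub>Q\<^esub> h \<beta> \<oplus>\<^bsub>Q\<^esub> h ?t"
        by (simp add: s h_mult h_add scale_def)
      ultimately show "u \<in> Q.line_extension K (h \<beta>) (?E B)"
        unfolding Q.line_extension_mem_iff K_def by blast
    qed
    ultimately show ?case using insert.hyps by simp
  qed
  obtain B where B: "B \<subseteq> partials f" "mp.independent B" "partials f \<subseteq> mp.span B"
      "card B = mp.dim (partials f)"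
    using mp.basis_exists[of "partials f"] by metis
  have "finite B" using mp.independent_span_bound[OF fin(1) B(2)] B(1) fin(2) by auto
  from dimension[OF this B(2,1)] have "Q.dimension (card B) K (carrier Q)"
    using B(3) by (auto simp: carr partials_def full_SetCompr_eq Collect_conj_eq image_subset_iff)
  then have "Q.dim K (carrier Q) = card B"
    using Q.dimI[OF K] by (simp add: over_def)
  then show ?thesis
    by (simp add: dim_Ap_def Q_def K_def h_def R_def B(4))
qed

section \<open>Monomials in given elements\<close>

text \<open>Independence of a set forgets repetitions, so distinctness is shown as well: two equal
  members would satisfy \<open>h i - h j = 0\<close>.\<close>

lemma mp_family_independent:
  fixes h :: "'i \<Rightarrow> ('v, 'k::field) mpoly"
  assumes fin: "finite J"
    and zero: "\<And>c j. (\<Sum>j\<in>J. scale (c j) (h j)) = 0 \<Longrightarrow> j \<in> J \<Longrightarrow> c j = 0"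
  shows "inj_on h J" "mp.independent (h ` J)"
proof -
  show inj: "inj_on h J"
  proof (rule inj_onI, rule ccontr)
    fix i j assume ij: "i \<in> J" "j \<in> J" "h i = h j" "i \<noteq> j"
    let ?c = "\<lambda>k. if k = i then 1 else if k = j then - 1 else (0 :: 'k)"
    have "(\<Sum>k\<in>J. scale (?c k) (h k)) = (\<Sum>k\<in>{i, j}. scale (?c k) (h k))"
      using ij fin by (intro sum.mono_neutral_right) auto
    also have "\<dots> = 0" using ij by simp
    finally have "?c i = 0" by (rule zero) (rule ij(1))
    then show False by simp
  qed
  show "mp.independent (h ` J)"
  proof (rule mp.independent_if_scalars_zero)
    fix g x assume "(\<Sum>x\<in>h ` J. scale (g x) x) = 0" "x \<in> h ` J"
    then show "g x = 0" using zero[of "g \<circ> h"] inj by (auto simp: sum.reindex)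
  qed (use fin in simp)
qed

lemma mp_family_scalars_zero:
  fixes h :: "'i \<Rightarrow> ('v, 'k::field) mpoly"
  assumes "finite J" "inj_on h J" "mp.independent (h ` J)"
    and "(\<Sum>j\<in>J. scale (c j) (h j)) = 0" "j \<in> J"
  shows "c j = 0"
proof -
  have "(\<Sum>x\<in>h ` J. scale (c (inv_into J h x)) x) = (\<Sum>j\<in>J. scale (c j) (h j))"
    using assms(2) by (simp add: sum.reindex)
  with assms have "c (inv_into J h (h j)) = 0"
    by (intro mp.independentD[of "h ` J" "h ` J" "\<lambda>x. c (inv_into J h x)"]) auto
  with assms show ?thesis by simp
qed

text \<open>The target is any commutative monoid, so that the same notation serves for points and
  for polynomials.\<close>

definition monom_at :: "('w \<Rightarrow> 'a::comm_monoid_mult) \<Rightarrow> 'w monom \<Rightarrow> 'a" where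
  "monom_at g m = (\<Prod>v\<in>keys m. g v ^ lookup m v)"

lemma monom_at_superset: "finite A \<Longrightarrow> keys m \<subseteq> A \<Longrightarrow> monom_at g m = (\<Prod>v\<in>A. g v ^ lookup m v)"
  unfolding monom_at_def by (rule prod.mono_neutral_left) (auto simp: in_keys_iff)

lemma monom_at_zero [simp]: "monom_at g 0 = 1"
  by (simp add: monom_at_def)

lemma monom_at_single [simp]: "monom_at g (Poly_Mapping.single i n) = g i ^ n"
  by (cases "n = 0") (simp_all add: monom_at_def)

lemma monom_at_add: "monom_at g (a + b) = monom_at g a * monom_at g b"
proof -
  have *: "keys (a + b) \<subseteq> keys a \<union> keys b" by (rule keys_add)
  show ?thesis
    unfolding monom_at_superset[OF _ *, simplified]
      monom_at_superset[of "keys a \<union> keys b" a, simplified]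
      monom_at_superset[of "keys a \<union> keys b" b, simplified]
    by (simp add: lookup_add power_add prod.distrib)
qed

lemma subst_poly_superset:
  assumes "finite A" "keys p \<subseteq> A"
  shows "subst_poly g p = (\<Sum>m\<in>A. scale (lookup p m) (monom_at g m))"
  unfolding eval_in_def monom_at_def scale_def
  by (rule sum.mono_neutral_left) (use assms in \<open>auto simp: in_keys_iff const_def\<close>)

lemma mp_independent_if_dim_eq_card:
  assumes "finite S" "mp.dim S = card S"
  shows "mp.independent (S :: ('v, 'k::field) mpoly set)"
proof -
  obtain B where B: "B \<subseteq> S" "mp.independent B" "card B = mp.dim S"
    using mp.basis_exists[of S] by metis
  then have "B = S" using card_subset_eq[OF assms(1) B(1)] assms(2) by simp
  with B show ?thesis by simp
qed

text \<open>The set \<open>E\<close> of admissible exponents separates the variants: degree exactly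
  \<open>d\<close> for homogeneous relations, degree at most \<open>d\<close>, or all
  degrees.\<close>

definition alg_indep_on :: "('w \<Rightarrow> ('v, 'k::field) mpoly) \<Rightarrow> 'w monom set \<Rightarrow> bool" where
  "alg_indep_on g E \<longleftrightarrow> (\<forall>p. keys p \<subseteq> E \<longrightarrow> subst_poly g p = 0 \<longrightarrow> p = 0)"

text \<open>Substitution turns a polynomial with exponents in \<open>E\<close> into the same linear
  combination of the products \<open>monom_at g m\<close>.\<close>

lemma alg_indep_on_iff_dim:
  assumes fin: "finite E"
  shows "alg_indep_on g E \<longleftrightarrow> mp.dim (mp.span (monom_at g ` E)) = card E"
proof
  assume indep: "alg_indep_on g E"
  have zero: "c m = 0" if "(\<Sum>m\<in>E. scale (c m) (monom_at g m)) = 0" "m \<in> E" for c m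
  proof -
    define p where "p = (\<Sum>m\<in>E. Poly_Mapping.single m (c m))"
    have lookup: "lookup p m = (if m \<in> E then c m else 0)" for m
      using fin by (auto simp: p_def lookup_sum lookup_single when_def)
    then have "keys p \<subseteq> E" by (auto simp: in_keys_iff split: if_splits)
    moreover from this have "subst_poly g p = 0"
      using that(1) by (simp add: subst_poly_superset[OF fin] lookup cong: sum.cong)
    ultimately have "p = 0" using indep by (auto simp: alg_indep_on_def)
    with lookup[of m] that(2) show ?thesis by simp
  qed
  have fam: "inj_on (monom_at g) E" "mp.independent (monom_at g ` E)"
    using mp_family_independent[OF fin, of "monom_at g"] zero by blast+
  show "mp.dim (mp.span (monom_at g ` E)) = card E"
    using fam by (simp add: mp.dim_eq_card_independent card_image)
next
  assume dim: "mp.dim (mp.span (monom_at g ` E)) = card E"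
  have "mp.dim (monom_at g ` E) \<le> card (monom_at g ` E)"
    using fin by (intro mp.dim_le_card) (auto intro: mp.span_base)
  \<comment> \<open>The dimension is at most the number of distinct products, so no two exponents
    give the same product.\<close>
  then have card: "card (monom_at g ` E) = card E"
    using dim card_image_le[OF fin, of "monom_at g"] by simp
  then have inj: "inj_on (monom_at g) E" by (simp add: eq_card_imp_inj_on fin)
  have ind: "mp.independent (monom_at g ` E)"
    using fin dim card by (intro mp_independent_if_dim_eq_card) auto
  show "alg_indep_on g E"
    unfolding alg_indep_on_def
  proof (intro allI impI)
    fix p assume p: "keys p \<subseteq> E" "subst_poly g p = 0"
    from p(2) have "lookup p m = 0" if "m \<in> E" for m
      using mp_family_scalars_zero[OF fin inj ind _ that] unfolding subst_poly_superset[OF fin p(1)]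
      by blast
    then show "p = 0"
      using p(1) by (intro poly_mapping_eqI) (metis in_keys_iff in_mono lookup_zero)
  qed
qed

section \<open>Counting monomials\<close>

lemma ex_monom_map_lookup:
  assumes "distinct xs" "length l = length xs"
  shows "\<exists>m. keys m \<subseteq> set xs \<and> map (lookup m) xs = (l :: nat list)"
proof -
  define m where "m = (\<Sum>j<length xs. Poly_Mapping.single (xs ! j) (l ! j))"
  have lookup: "lookup m v = (\<Sum>j<length xs. if xs ! j = v then l ! j else 0)" for v
    by (auto simp: m_def lookup_sum lookup_single when_def)
  have "keys m \<subseteq> set xs"
  proof
    fix v assume v: "v \<in> keys m"
    show "v \<in> set xs"
    proof (rule ccontr)
      assume "v \<notin> set xs"
      then have "lookup m v = 0"
        unfolding lookup by (intro sum.neutral) auto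
      with v show False by (simp add: in_keys_iff)
    qed
  qed
  moreover have "map (lookup m) xs = l"
  proof (rule nth_equalityI)
    fix i assume "i < length (map (lookup m) xs)"
    then have i: "i < length xs" by simp
    have "lookup m (xs ! i) = (\<Sum>j<length xs. if j = i then l ! j else 0)"
      unfolding lookup using i assms(1) by (intro sum.cong) (auto simp: nth_eq_iff_index_eq)
    then show "map (lookup m) xs ! i = l ! i" using i by simp
  qed (use assms in simp)
  ultimately show ?thesis by blast
qed

text \<open>Listing exponents in a fixed order reduces the count to lists of naturals with
  prescribed sum.\<close>

lemma bij_betw_monoms_lists:
  assumes xs: "distinct xs" "set xs = S"
  shows "bij_betw (\<lambda>m. map (lookup m) xs) {m. keys m \<subseteq> S \<and> mdeg m = d}
    {l. length l = length xs \<and> sum_list l = d}"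
proof (rule bij_betwI')
  fix m m' assume m: "m \<in> {m. keys m \<subseteq> S \<and> mdeg m = d}" "m' \<in> {m. keys m \<subseteq> S \<and> mdeg m = d}"
  show "(map (lookup m) xs = map (lookup m') xs) = (m = m')"
  proof
    assume eq: "map (lookup m) xs = map (lookup m') xs"
    show "m = m'"
    proof (rule poly_mapping_eqI)
      fix v show "lookup m v = lookup m' v"
      proof (cases "v \<in> S")
        case True
        then show ?thesis using eq xs by (simp add: map_eq_conv)
      next
        case False
        then have "v \<notin> keys m" "v \<notin> keys m'" using m by auto
        then show ?thesis by (simp add: in_keys_iff)
      qed
    qed
  qed simp
next
  have mdeg: "mdeg m = sum_list (map (lookup m) xs)" if "keys m \<subseteq> S" for m
    using that xs mdeg_superset[of S m] by (auto simp: sum_list_distinct_conv_sum_set)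
  show "map (lookup m) xs \<in> {l. length l = length xs \<and> sum_list l = d}"
    if "m \<in> {m. keys m \<subseteq> S \<and> mdeg m = d}" for m
    using that mdeg[of m] by simp
  show "\<exists>m\<in>{m. keys m \<subseteq> S \<and> mdeg m = d}. l = map (lookup m) xs"
    if "l \<in> {l. length l = length xs \<and> sum_list l = d}" for l
    using that ex_monom_map_lookup[OF xs(1), of l] mdeg xs(2) by force
qed

text \<open>Stars and bars. Truncated subtraction gives the right count for empty \<open>S\<close>
  too: 1 for \<open>d = 0\<close> and 0 otherwise.\<close>

lemma card_monoms_eq:
  assumes "finite S"
  shows "card {m. keys m \<subseteq> S \<and> mdeg m = d} = (card S + d - 1) choose d"
proof -
  obtain xs where xs: "set xs = S" "distinct xs" using finite_distinct_list[OF assms] by blast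
  then have "length xs = card S" by (metis distinct_card)
  then show ?thesis
    using bij_betw_same_card[OF bij_betw_monoms_lists[OF xs(2,1), of d]]
      card_length_sum_list[of "length xs" d] by (simp add: add.commute)
qed

lemma finite_monoms_eq:
  assumes "finite S"
  shows "finite {m :: 'v monom. keys m \<subseteq> S \<and> mdeg m = d}"
proof -
  obtain xs where xs: "set xs = S" "distinct xs" using finite_distinct_list[OF assms] by blast
  have "finite {l :: nat list. length l = length xs \<and> sum_list l = d}"
  proof (rule finite_subset)
    show "{l. length l = length xs \<and> sum_list l = d} \<subseteq> {l. set l \<subseteq> {..d} \<and> length l = length xs}"
      using member_le_sum_list by auto
    show "finite {l. set l \<subseteq> {..d} \<and> length l = length xs}"
      by (rule finite_lists_length_eq) simp
  qed
  then show ?thesis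
    using bij_betw_finite[OF bij_betw_monoms_lists[OF xs(2,1), of d]] by simp
qed

lemma monoms_le_eq_UN: "{m. keys m \<subseteq> S \<and> mdeg m \<le> d} = (\<Union>k\<le>d. {m. keys m \<subseteq> S \<and> mdeg m = k})"
  by auto

lemma finite_monoms_le: "finite S \<Longrightarrow> finite {m. keys m \<subseteq> S \<and> mdeg m \<le> d}"
  unfolding monoms_le_eq_UN by (auto intro: finite_monoms_eq)

text \<open>Summing over the exact degrees gives the hockey-stick identity; empty \<open>S\<close>
  is separated because it has no predecessor cardinality \<open>r\<close>.\<close>

lemma card_monoms_le:
  assumes "finite S"
  shows "card {m. keys m \<subseteq> S \<and> mdeg m \<le> d} = (card S + d) choose d"
proof (cases "card S")
  case 0
  then have "{m. keys m \<subseteq> S \<and> mdeg m \<le> d} = {0}" using assms by auto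
  then show ?thesis using 0 by simp
next
  case (Suc r)
  have "card {m. keys m \<subseteq> S \<and> mdeg m \<le> d} = (\<Sum>k\<le>d. card {m. keys m \<subseteq> S \<and> mdeg m = k})"
    unfolding monoms_le_eq_UN using assms by (intro card_UN_disjoint) (auto intro: finite_monoms_eq)
  also have "\<dots> = (\<Sum>k\<le>d. (r + k) choose k)"
    using Suc by (simp add: card_monoms_eq[OF assms])
  also have "\<dots> = Suc (r + d) choose d"
    by (rule sum_choose_lower)
  finally show ?thesis using Suc by simp
qed

section \<open>Powers of a space of polynomials\<close>

primrec pow_space :: "('v, 'k::field) mpoly set \<Rightarrow> nat \<Rightarrow> ('v, 'k) mpoly set" where
  "pow_space V 0 = mp.span {1}"
| "pow_space V (Suc d) = mp.span {v * g | v g. v \<in> V \<and> g \<in> pow_space V d}"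

lemma subspace_pow_space: "mp.subspace (pow_space V d)"
  by (cases d) auto

lemma pow_space_SucI: "v \<in> V \<Longrightarrow> g \<in> pow_space V d \<Longrightarrow> v * g \<in> pow_space V (Suc d)"
  by (auto intro!: mp.span_base)

lemma power_in_pow_space: "v \<in> V \<Longrightarrow> v ^ d \<in> pow_space V d"
proof (induction d)
  case (Suc d)
  then show ?case using pow_space_SucI by (simp only: power_Suc) blast
qed (auto intro: mp.span_base)

lemma mp_linear_mult_left: "mp_linear ((*) p)"
  by (rule mp_linearI) (simp_all add: algebra_simps scale_mult_right)

lemma mult_in_subspaceI:
  assumes "mp.subspace W" "x \<in> mp.span A" "y \<in> mp.span B"
    and "\<And>a b. a \<in> A \<Longrightarrow> b \<in> B \<Longrightarrow> a * b \<in> W"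
  shows "x * y \<in> W"
proof -
  have 1: "a * y \<in> W" if "a \<in> A" for a
    using assms(3)
  proof (induction rule: mp.span_induct)
    case base
    show ?case using mpp.linear_subspace_vimage[OF mp_linear_mult_left assms(1), of a]
      by (simp add: vimage_def)
  qed (use assms(4) that in auto)
  from assms(2) show ?thesis
  proof (induction rule: mp.span_induct)
    case base
    show ?case using mpp.linear_subspace_vimage[OF mp_linear_mult_left assms(1), of y]
      by (simp add: vimage_def mult.commute)
  qed (use 1 in auto)
qed

text \<open>Splitting one variable off an exponent vector matches the recursion of
  \<open>pow_space\<close>.\<close>

lemma pow_space_eq_span_monoms:
  assumes V: "V = mp.span (g ` S)"
  shows "pow_space V d = mp.span (monom_at g ` {m. keys m \<subseteq> S \<and> mdeg m = d})"
proof (induction d)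
  case 0
  have "{m. keys m \<subseteq> S \<and> mdeg m = 0} = {0}" by auto
  then show ?case by simp
next
  case (Suc d)
  show ?case
  proof
    show "pow_space V (Suc d) \<subseteq> mp.span (monom_at g ` {m. keys m \<subseteq> S \<and> mdeg m = Suc d})"
      unfolding pow_space.simps
    proof (rule mp.span_minimal, clarify)
      fix v h assume "v \<in> V" "h \<in> pow_space V d"
      then have v: "v \<in> mp.span (g ` S)"
        and h: "h \<in> mp.span (monom_at g ` {m. keys m \<subseteq> S \<and> mdeg m = d})"
        by (simp_all only: V[symmetric] Suc.IH)
      show "v * h \<in> mp.span (monom_at g ` {m. keys m \<subseteq> S \<and> mdeg m = Suc d})"
      proof (rule mult_in_subspaceI[OF mp.subspace_span v h])
        fix a b assume "a \<in> g ` S" "b \<in> monom_at g ` {m. keys m \<subseteq> S \<and> mdeg m = d}"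
        then obtain i m where "i \<in> S" "a = g i" "keys m \<subseteq> S" "mdeg m = d" "b = monom_at g m" by auto
        then have "a * b = monom_at g (Poly_Mapping.single i 1 + m)"
            "keys (Poly_Mapping.single i 1 + m) \<subseteq> S" "mdeg (Poly_Mapping.single i 1 + m) = Suc d"
          using keys_add[of "Poly_Mapping.single i 1" m] by (auto simp: monom_at_add mdeg_add)
        then show "a * b \<in> mp.span (monom_at g ` {m. keys m \<subseteq> S \<and> mdeg m = Suc d})"
          by (auto intro!: mp.span_base)
      qed
    qed simp
    show "mp.span (monom_at g ` {m. keys m \<subseteq> S \<and> mdeg m = Suc d}) \<subseteq> pow_space V (Suc d)"
    proof (rule mp.span_minimal, clarify)
      fix m assume "keys m \<subseteq> S" "mdeg m = Suc d"
      then obtain i m' where m: "i \<in> S" "m = m' + Poly_Mapping.single i 1" "keys m' \<subseteq> S" "mdeg m' = d"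
        by (rule monom_cases)
      have "g i \<in> V" unfolding V using m by (auto intro: mp.span_base)
      moreover have "monom_at g m' \<in> pow_space V d"
        unfolding Suc.IH using m by (auto intro: mp.span_base)
      ultimately have "g i * monom_at g m' \<in> pow_space V (Suc d)" by (rule pow_space_SucI)
      then show "monom_at g m \<in> pow_space V (Suc d)"
        unfolding m(2) monom_at_add by (simp add: mult.commute)
    qed (rule subspace_pow_space)
  qed
qed

text \<open>This is dehomogenization: factors 1 disappear, so products of \<open>d\<close>
  generators become monomials of degree at most \<open>d\<close> in the others.\<close>

lemma pow_space_eq_span_monoms_le:
  assumes V: "V = mp.span (insert 1 (g ` S))"
  shows "pow_space V d = mp.span (monom_at g ` {m. keys m \<subseteq> S \<and> mdeg m \<le> d})"
proof (induction d)
  case 0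
  have "{m. keys m \<subseteq> S \<and> mdeg m \<le> 0} = {0}" by auto
  then show ?case by simp
next
  case (Suc d)
  let ?U = "mp.span (monom_at g ` {m. keys m \<subseteq> S \<and> mdeg m \<le> Suc d})"
  show ?case
  proof
    show "pow_space V (Suc d) \<subseteq> ?U"
      unfolding pow_space.simps
    proof (rule mp.span_minimal, clarify)
      fix v h assume "v \<in> V" "h \<in> pow_space V d"
      then have v: "v \<in> mp.span (insert 1 (g ` S))"
        and h: "h \<in> mp.span (monom_at g ` {m. keys m \<subseteq> S \<and> mdeg m \<le> d})"
        by (simp_all only: V[symmetric] Suc.IH)
      show "v * h \<in> ?U"
      proof (rule mult_in_subspaceI[OF mp.subspace_span v h])
        fix a b assume a: "a \<in> insert 1 (g ` S)" and "b \<in> monom_at g ` {m. keys m \<subseteq> S \<and> mdeg m \<le> d}"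
        then obtain m where m: "keys m \<subseteq> S" "mdeg m \<le> d" "b = monom_at g m" by auto
        from a show "a * b \<in> ?U"
        proof
          assume "a = 1"
          then show ?thesis using m by (auto intro!: mp.span_base)
        next
          assume "a \<in> g ` S"
          then obtain i where "i \<in> S" "a = g i" by auto
          with m have "a * b = monom_at g (Poly_Mapping.single i 1 + m)"
              "keys (Poly_Mapping.single i 1 + m) \<subseteq> S" "mdeg (Poly_Mapping.single i 1 + m) \<le> Suc d"
            using keys_add[of "Poly_Mapping.single i 1" m] by (auto simp: monom_at_add mdeg_add)
          then show ?thesis by (auto intro!: mp.span_base)
        qed
      qed
    qed simp
    show "?U \<subseteq> pow_space V (Suc d)"
    proof (rule mp.span_minimal, clarify)
      fix m assume mS: "keys m \<subseteq> S" and le: "mdeg m \<le> Suc d"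
      show "monom_at g m \<in> pow_space V (Suc d)"
      proof (cases "mdeg m = Suc d")
        case True
        with mS obtain i m' where
          m: "i \<in> S" "m = m' + Poly_Mapping.single i 1" "keys m' \<subseteq> S" "mdeg m' = d"
          by (rule monom_cases)
        have "g i \<in> V" unfolding V using m by (auto intro: mp.span_base)
        moreover have "monom_at g m' \<in> pow_space V d"
          unfolding Suc.IH using m by (auto intro: mp.span_base)
        ultimately have "g i * monom_at g m' \<in> pow_space V (Suc d)" by (rule pow_space_SucI)
        then show ?thesis
          unfolding m(2) monom_at_add by (simp add: mult.commute)
      next
        \<comment> \<open>A monomial of lower degree is padded with the factor 1.\<close>
        case False
        then have "monom_at g m \<in> pow_space V d"
          unfolding Suc.IH using mS le by (auto intro: mp.span_base)
        moreover have "1 \<in> V" unfolding V by (auto intro: mp.span_base)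
        ultimately have "1 * monom_at g m \<in> pow_space V (Suc d)" by (intro pow_space_SucI)
        then show ?thesis by simp
      qed
    qed (rule subspace_pow_space)
  qed
qed

text \<open>The Leibniz rule differentiates one factor at a time, and that factor stays in
  \<open>V\<close>.\<close>

lemma pow_space_closed_pd:
  assumes V: "\<And>v. v \<in> V \<Longrightarrow> pd i v \<in> V" and g: "g \<in> pow_space V d"
  shows "pd i g \<in> pow_space V d"
  using g
proof (induction d arbitrary: g)
  case 0
  have "pd i 1 = (0 :: ('a, 'b) mpoly)"
    using pd_single[of i 0 1] by simp
  then have "mp.span {1} \<subseteq> pd i -` (mp.span {1 :: ('a, 'b) mpoly})"
    by (intro mp.span_minimal mpp.linear_subspace_vimage pd_linear) (simp_all add: mp.span_zero)
  then show ?case using 0 by auto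
next
  case (Suc d)
  have "mp.span {v * g | v g. v \<in> V \<and> g \<in> pow_space V d} \<subseteq> pd i -` pow_space V (Suc d)"
  proof (intro mp.span_minimal mpp.linear_subspace_vimage pd_linear subspace_pow_space, clarify)
    fix v g assume vg: "v \<in> V" "g \<in> pow_space V d"
    show "v * g \<in> pd i -` pow_space V (Suc d)"
      unfolding vimage_def mem_Collect_eq pd_mult
      by (intro mp.subspace_add subspace_pow_space pow_space_SucI vg V Suc.IH)
  qed
  then show ?case using Suc.prems by auto
qed

lemma partials_power_subset: "partials (f ^ d) \<subseteq> pow_space (partials (f :: ('n::finite, 'k::field) mpoly)) d"
  by (intro partials_minimal subspace_pow_space power_in_pow_space self_in_partials
      pow_space_closed_pd pd_in_partials)

lemma partials_power_eq:
  fixes f :: "('n::finite, 'k::field_char_0) mpoly"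
  assumes V: "partials f = mp.span (insert f (range (\<lambda>i. pd i f)))"
  shows "partials (f ^ d) = pow_space (partials f) d"
proof
  let ?V = "partials f" and ?W = "partials (f ^ d)"
  \<comment> \<open>Factors \<open>f\<close> are exchanged for arbitrary elements of
    \<open>?V\<close> one at a time; at \<open>k = d\<close> no power of \<open>f\<close> is
    left.\<close>
  have "f ^ (d - k) * g \<in> ?W" if "k \<le> d" "g \<in> pow_space ?V k" for k g
    using that
  proof (induction k arbitrary: g)
    case 0
    have "mp.span {1} \<subseteq> (*) (f ^ d) -` ?W"
      by (intro mp.span_minimal mpp.linear_subspace_vimage mp_linear_mult_left)
        (simp_all add: self_in_partials subspace_partials)
    then show ?case using 0 by auto
  next
    case (Suc k)
    let ?e = "d - Suc k"
    have e: "d - k = Suc ?e" using Suc.prems by simp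
    have "mp.span {v * g | v g. v \<in> ?V \<and> g \<in> pow_space ?V k} \<subseteq> (*) (f ^ ?e) -` ?W"
    proof (intro mp.span_minimal mpp.linear_subspace_vimage mp_linear_mult_left subspace_partials, clarify)
      fix v g assume v: "v \<in> ?V" and g: "g \<in> pow_space ?V k"
      have IH: "f ^ Suc ?e * h \<in> ?W" if "h \<in> pow_space ?V k" for h
        using Suc.IH[OF _ that] Suc.prems(1) e by simp
      have step: "f ^ ?e * (pd i f * g) \<in> ?W" for i
      proof -
        have "pd i (f ^ Suc ?e * g) - f ^ Suc ?e * pd i g = scale (of_nat (Suc ?e)) (f ^ ?e * (pd i f * g))"
          unfolding pd_mult pd_power_Suc scale_mult_left by (simp add: ac_simps)
        moreover have "pd i (f ^ Suc ?e * g) - f ^ Suc ?e * pd i g \<in> ?W"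
          by (intro mp.subspace_diff subspace_partials pd_in_partials IH g pow_space_closed_pd)
        \<comment> \<open>Characteristic zero allows division by the exponent \<open>d - k\<close>
          of \<open>f\<close>.\<close>
        ultimately have "scale (1 / of_nat (Suc ?e)) (scale (of_nat (Suc ?e)) (f ^ ?e * (pd i f * g))) \<in> ?W"
          by (metis mp.subspace_scale subspace_partials)
        moreover have "(of_nat (Suc ?e) :: 'k) \<noteq> 0" by (rule of_nat_neq_0)
        ultimately show ?thesis by (simp del: of_nat_Suc)
      qed
      have "mp.span (insert f (range (\<lambda>i. pd i f))) \<subseteq> (*) (f ^ ?e * g) -` ?W"
        using step IH[OF g]
        by (intro mp.span_minimal mpp.linear_subspace_vimage mp_linear_mult_left subspace_partials)
          (auto simp: ac_simps)
      with v have "f ^ ?e * g * v \<in> ?W" by (subst (asm) V) auto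
      then show "v * g \<in> (*) (f ^ ?e) -` ?W" by (simp add: ac_simps)
    qed
    then show ?case using Suc.prems by auto
  qed
  from this[of d] show "pow_space ?V d \<subseteq> ?W" by auto
qed (rule partials_power_subset)

section \<open>Evaluation and dominance\<close>

text \<open>
  Unification may leave \<open>eval_at\<close> with an eta-expanded \<open>id\<close>, which the simplifier turns
  into \<open>\<lambda>a. a\<close>; the following rule restores the form in which the rules below are stated.
\<close>

lemma eval_in_ident [simp]: "eval_in (\<lambda>a. a) = eval_at"
  by (simp add: id_def)

lemma eval_at_superset:
  assumes "finite A" "keys p \<subseteq> A"
  shows "eval_at x p = (\<Sum>m\<in>A. lookup p m * monom_at x m)"
  unfolding eval_in_def monom_at_def id_apply
  by (rule sum.mono_neutral_left) (use assms in \<open>auto simp: in_keys_iff\<close>)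

lemma eval_at_single [simp]: "eval_at x (Poly_Mapping.single m c) = c * monom_at x (m :: 'v monom)"
  by (cases "c = 0") (simp_all add: eval_in_def monom_at_def)

lemma eval_at_zero [simp]: "eval_at x 0 = 0"
  by (simp add: eval_in_def)

lemma eval_at_add: "eval_at x (p + q) = eval_at x p + eval_at x q"
proof -
  have *: "keys (p + q) \<subseteq> keys p \<union> keys q" by (rule keys_add)
  show ?thesis
    unfolding eval_at_superset[OF _ *, simplified]
      eval_at_superset[of "keys p \<union> keys q" p, simplified]
      eval_at_superset[of "keys p \<union> keys q" q, simplified]
    by (simp add: lookup_add algebra_simps sum.distrib)
qed

lemma eval_at_mult: "eval_at x (p * q) = eval_at x p * eval_at x (q :: ('v, 'k::field) mpoly)"
proof (induction p rule: mpoly_induct)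
  case (single m c)
  show ?case
    by (induction q rule: mpoly_induct)
      (simp_all add: mult_single monom_at_add eval_at_add algebra_simps)
qed (simp_all add: eval_at_add algebra_simps)

lemma eval_at_scale: "eval_at x (scale c p) = c * eval_at x (p :: ('v, 'k::field) mpoly)"
  by (simp add: scale_def const_def eval_at_mult)

lemma eval_at_one [simp]: "eval_at x (1 :: ('v, 'k::field) mpoly) = 1"
  using eval_at_single[of x 0 1] by simp

lemma eval_at_power: "eval_at x (p ^ d) = eval_at x (p :: ('v, 'k::field) mpoly) ^ d"
  by (induction d) (simp_all add: eval_at_mult)

lemma eval_at_sum: "eval_at x (\<Sum>j\<in>J. h j) = (\<Sum>j\<in>J. eval_at x (h j :: ('v, 'k::field) mpoly))"
  by (induction J rule: infinite_finite_induct) (simp_all add: eval_at_add)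

lemma eval_at_monom_at: "eval_at x (monom_at g m) = monom_at (\<lambda>v. eval_at x (g v :: ('v, 'k::field) mpoly)) m"
  by (induction m rule: monom_induct) (simp_all add: monom_at_add eval_at_mult)

lemma eval_at_subst_poly:
  "eval_at x (subst_poly g p) = eval_at (\<lambda>v. eval_at x (g v :: ('v, 'k::field) mpoly)) p"
  unfolding subst_poly_superset[OF finite_keys order_refl]
    eval_at_superset[OF finite_keys order_refl, of _ p]
  by (simp add: eval_at_sum eval_at_scale eval_at_monom_at)

text \<open>
  A polynomial that vanishes at all points has partial derivatives with the same property,
  because its restriction to every line parallel to an axis is the zero polynomial.
\<close>

lemma eval_at_line_poly:
  fixes p :: "('v, 'k::field) mpoly"
  shows "\<exists>P. \<forall>t. poly P t = eval_at (x(i := t)) p \<and> poly (pderiv P) t = eval_at (x(i := t)) (pd i p)"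
proof (induction p rule: mpoly_induct)
  case (single m c)
  show ?case
  proof (induction m rule: monom_induct)
    case zero
    show ?case by (rule exI[of _ "[:c:]"]) (simp add: pd_single)
  next
    case (add m j)
    then obtain P where P: "poly P t = eval_at (x(i := t)) (Poly_Mapping.single m c)"
      "poly (pderiv P) t = eval_at (x(i := t)) (pd i (Poly_Mapping.single m c))" for t by blast
    have split: "Poly_Mapping.single (m + Poly_Mapping.single j 1) c
        = Poly_Mapping.single m c * Poly_Mapping.single (Poly_Mapping.single j 1) 1"
      by (simp add: mult_single)
    \<comment> \<open>On the line the variable \<open>i\<close> becomes the parameter, and every
      other variable is constant.\<close>
    let ?Q = "if j = i then [:0, 1:] else [:x j:]"
    have Q: "poly ?Q t = eval_at (x(i := t)) (Poly_Mapping.single (Poly_Mapping.single j 1) 1)"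
      "poly (pderiv ?Q) t = eval_at (x(i := t)) (pd i (Poly_Mapping.single (Poly_Mapping.single j 1) 1))" for t
      by (auto simp: pd_single lookup_single pderiv_pCons simp del: single_one)
    show ?case
      unfolding split pd_mult
      by (rule exI[of _ "P * ?Q"]) (simp add: P Q pderiv_mult eval_at_mult eval_at_add algebra_simps del: eval_at_single fun_upd_apply)
  qed
next
  case (add p q)
  then obtain P Q where "\<forall>t. poly P t = eval_at (x(i := t)) p \<and> poly (pderiv P) t = eval_at (x(i := t)) (pd i p)"
    "\<forall>t. poly Q t = eval_at (x(i := t)) q \<and> poly (pderiv Q) t = eval_at (x(i := t)) (pd i q)" by blast
  then show ?case by (intro exI[of _ "P + Q"]) (simp add: pderiv_add eval_at_add pd_add del: fun_upd_apply)
qed (auto intro: exI[of _ 0])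

lemma eval_at_pd_eq_0:
  fixes p :: "('v, 'k::field_char_0) mpoly"
  assumes "\<And>x. eval_at x p = 0"
  shows "eval_at x (pd i p) = 0"
proof -
  obtain P where P: "\<forall>t. poly P t = eval_at (x(i := t)) p \<and> poly (pderiv P) t = eval_at (x(i := t)) (pd i p)"
    using eval_at_line_poly[of x i p] by blast
  \<comment> \<open>A univariate polynomial that vanishes on an infinite field is zero.\<close>
  then have "P = 0" using assms by (simp add: poly_all_0_iff_0[symmetric])
  with P have "eval_at (x(i := x i)) (pd i p) = 0" by (metis pderiv_0 poly_0)
  then show ?thesis by simp
qed

lemma eval_at_origin: "eval_at (\<lambda>_. 0) p = lookup (p :: ('v, 'k::field) mpoly) 0"
proof (induction p rule: mpoly_induct)
  case (single m c)
  have "monom_at (\<lambda>_. 0) m = (0 :: 'k)" if nz: "m \<noteq> 0"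
  proof -
    obtain v where "v \<in> keys m" using nz by (metis all_not_in_conv keys_eq_empty)
    then show ?thesis
      unfolding monom_at_def by (intro prod_zero) (auto simp: in_keys_iff intro!: bexI[of _ v])
  qed
  then show ?case by (cases "m = 0") (simp_all add: lookup_single)
qed (simp_all add: eval_at_add lookup_add)

text \<open>All iterated derivatives vanish everywhere, in particular at the origin, where they give
  the coefficients up to positive integers.\<close>

lemma mpoly_eq_0_if_eval_0:
  fixes p :: "('v, 'k::field_char_0) mpoly"
  assumes "\<And>x. eval_at x p = 0"
  shows "p = 0"
proof (rule poly_mapping_eqI)
  fix m
  show "lookup p m = lookup 0 m"
    using assms
  proof (induction m arbitrary: p rule: monom_induct)
    case zero
    show ?case using zero[of "\<lambda>_. 0"] by (simp add: eval_at_origin)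
  next
    case (add m i)
    have "lookup (pd i p) m = 0"
      using add.IH[of "pd i p"] eval_at_pd_eq_0[OF add.prems] by simp
    then have "of_nat (Suc (lookup m i)) * lookup p (m + Poly_Mapping.single i 1) = 0"
      unfolding lookup_pd .
    then show ?case by (simp del: of_nat_Suc)
  qed
qed

text \<open>A point where \<open>f\<close> does not vanish serves for its powers as well.\<close>

lemma mpoly_power_neq_0:
  fixes f :: "('v, 'k::field_char_0) mpoly"
  assumes "f \<noteq> 0"
  shows "f ^ d \<noteq> 0"
proof -
  obtain x where "eval_at x f \<noteq> 0" using assms mpoly_eq_0_if_eval_0 by blast
  then have "eval_at x (f ^ d) \<noteq> 0" by (simp add: eval_at_power)
  then show ?thesis by auto
qed

section \<open>Zariski density and algebraic relations\<close>

lemma eval_at_cong: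
  assumes "\<And>v. v \<in> vars p \<Longrightarrow> x v = y v"
  shows "eval_at x p = eval_at y p"
  unfolding eval_in_def
  by (intro refl sum.cong arg_cong2[where f = "(*)"] prod.cong arg_cong2[where f = "(^)"] assms)
    (auto simp: vars_def)

text \<open>A proper closed set has a nonzero equation, and a nonzero polynomial cuts out a proper
  closed set because it does not vanish at all points.\<close>

lemma zariski_closure_eq_aff_iff:
  fixes A :: "(nat \<Rightarrow> 'k::field_char_0) set"
  assumes "A \<subseteq> aff m"
  shows "zariski_closure m A = aff m \<longleftrightarrow>
    (\<forall>p. vars p \<subseteq> {..<m} \<longrightarrow> (\<forall>y\<in>A. eval_at y p = 0) \<longrightarrow> p = 0)"
proof
  assume closure: "zariski_closure m A = aff m"
  show "\<forall>p. vars p \<subseteq> {..<m} \<longrightarrow> (\<forall>y\<in>A. eval_at y p = 0) \<longrightarrow> p = 0"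
  proof (intro allI impI)
    fix p assume p: "vars p \<subseteq> {..<m}" "\<forall>y\<in>A. eval_at y p = 0"
    let ?Z = "{y \<in> aff m. \<forall>q\<in>{p}. eval_at y q = 0}"
    have "zariski_closed m ?Z"
      unfolding zariski_closed_def using p(1) by (intro exI[of _ "{p}"]) simp
    moreover have "A \<subseteq> ?Z" using assms p(2) by auto
    ultimately have "zariski_closure m A \<subseteq> ?Z" unfolding zariski_closure_def by blast
    then have Z: "aff m \<subseteq> ?Z" using closure by simp
    show "p = 0"
    proof (rule mpoly_eq_0_if_eval_0)
      fix x :: "nat \<Rightarrow> 'k"
      \<comment> \<open>Points of \<open>aff m\<close> are \<open>undefined\<close> beyond
        \<open>m\<close>, where \<open>p\<close> has no variables; restricting an arbitrary point
        does not change the value.\<close>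
      have "restrict x {..<m} \<in> aff m" by (auto simp: aff_def)
      then have "eval_at (restrict x {..<m}) p = 0" using Z by auto
      moreover have "eval_at (restrict x {..<m}) p = eval_at x p"
        using p(1) by (intro eval_at_cong) auto
      ultimately show "eval_at x p = 0" by simp
    qed
  qed
next
  assume *: "\<forall>p. vars p \<subseteq> {..<m} \<longrightarrow> (\<forall>y\<in>A. eval_at y p = 0) \<longrightarrow> p = 0"
  have "Z = aff m" if Z: "zariski_closed m Z" "A \<subseteq> Z" for Z
  proof -
    obtain S where S: "\<forall>p\<in>S. vars p \<subseteq> {..<m}" "Z = {y \<in> aff m. \<forall>p\<in>S. eval_at y p = 0}"
      using Z(1) unfolding zariski_closed_def by blast
    have "p = 0" if "p \<in> S" for p using that S Z(2) * by blast
    then have "eval_at y p = 0" if "p \<in> S" for y p using that eval_at_zero by metis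
    then show ?thesis using S(2) by auto
  qed
  moreover have "zariski_closed m (aff m :: (nat \<Rightarrow> 'k) set)"
    unfolding zariski_closed_def by (intro exI[of _ "{}"]) simp
  ultimately show "zariski_closure m A = aff m"
    unfolding zariski_closure_def using assms by blast
qed

lemma vars_subset_iff: "vars p \<subseteq> S \<longleftrightarrow> keys p \<subseteq> {m. keys m \<subseteq> S}"
  by (auto simp: vars_def)

text \<open>Pulling \<open>p\<close> back along the map is substitution, so the equations of the
  image are the algebraic relations between the components.\<close>

lemma dominant_total_grad_iff:
  fixes f :: "('n::finite, 'k::field_char_0) mpoly"
  shows "dominant (length as) (total_grad f as) \<longleftrightarrow>
    alg_indep_on (\<lambda>i. pdiff (as ! i) f) {m. keys m \<subseteq> {..<length as}}"
proof -
  let ?g = "\<lambda>i. pdiff (as ! i) f" and ?m = "length as"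
  have aff: "range (total_grad f as) \<subseteq> aff ?m"
    by (intro image_subsetI) (simp add: total_grad_def aff_def restrict_PiE_iff del: restrict_apply)
  have eval: "(\<forall>y\<in>range (total_grad f as). eval_at y p = 0) \<longleftrightarrow> subst_poly ?g p = 0"
    if p: "vars p \<subseteq> {..<?m}" for p
  proof -
    have "eval_at (total_grad f as x) p = eval_at x (subst_poly ?g p)" for x
      unfolding eval_at_subst_poly
      using p by (intro eval_at_cong) (auto simp: total_grad_def)
    then show ?thesis using mpoly_eq_0_if_eval_0[of "subst_poly ?g p"] by auto
  qed
  have "dominant ?m (total_grad f as) \<longleftrightarrow>
      (\<forall>p. vars p \<subseteq> {..<?m} \<longrightarrow> (\<forall>y\<in>range (total_grad f as). eval_at y p = 0) \<longrightarrow> p = 0)"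
    unfolding dominant_def using zariski_closure_eq_aff_iff[OF aff] aff by simp
  also have "\<dots> \<longleftrightarrow> alg_indep_on ?g {m. keys m \<subseteq> {..<?m}}"
    using eval unfolding alg_indep_on_def vars_subset_iff by blast
  finally show ?thesis .
qed

section \<open>Independence in terms of dimensions\<close>

text \<open>A relation has bounded degree, so each degree bound can be treated separately by
  counting monomials.\<close>

lemma alg_indep_on_iff_dim_pow_space:
  assumes "finite S"
  shows "alg_indep_on g {m. keys m \<subseteq> S} \<longleftrightarrow>
    (\<forall>d. mp.dim (pow_space (mp.span (insert 1 (g ` S))) d) = (card S + d) choose d)"
proof -
  have "alg_indep_on g {m. keys m \<subseteq> S} \<longleftrightarrow> (\<forall>d. alg_indep_on g {m. keys m \<subseteq> S \<and> mdeg m \<le> d})"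
    (is "?L \<longleftrightarrow> ?R")
  proof
    assume R: ?R
    show ?L
      unfolding alg_indep_on_def
    proof (intro allI impI)
      fix p assume p: "keys p \<subseteq> {m. keys m \<subseteq> S}" "subst_poly g p = 0"
      have "keys p \<subseteq> {m. keys m \<subseteq> S \<and> mdeg m \<le> Max (mdeg ` keys p)}"
        using p(1) by (auto intro!: Max_ge)
      with p(2) R show "p = 0" unfolding alg_indep_on_def by blast
    qed
  qed (auto simp: alg_indep_on_def)
  also have "\<dots> \<longleftrightarrow> (\<forall>d. mp.dim (pow_space (mp.span (insert 1 (g ` S))) d) = (card S + d) choose d)"
    using assms by (simp add: alg_indep_on_iff_dim finite_monoms_le card_monoms_le
        pow_space_eq_span_monoms_le[OF refl])
  finally show ?thesis .
qed

lemma is_basis_length: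
  assumes "is_basis vs V"
  shows "length vs = mp.dim V"
  using assms by (metis distinct_card is_basis_def mp.dim_span_eq_card_independent)

text \<open>A homogeneous relation lives in a single degree. As the dimensions do not mention a
  basis, all bases give the same answer.\<close>

lemma hom_alg_independent_iff:
  fixes V :: "('v, 'k::field) mpoly set"
  assumes V: "mp.subspace V" and fin: "finite S" "V \<subseteq> mp.span S"
  shows "hom_alg_independent V \<longleftrightarrow>
    (\<forall>d. mp.dim (pow_space V d) = (mp.dim V + d - 1) choose d)"
proof -
  obtain B where B: "B \<subseteq> V" "mp.independent B" "V \<subseteq> mp.span B"
    using mp.basis_exists[of V] by metis
  have "finite B" using mp.independent_span_bound[OF fin(1) B(2)] B(1) fin(2) by auto
  then obtain bs where "set bs = B" "distinct bs" using finite_distinct_list by blast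
  then have ex: "is_basis bs V"
    using B V by (auto simp: is_basis_def dest: mp.span_minimal)
  have iff: "\<not> (\<exists>p :: (nat, 'k) mpoly. p \<noteq> 0 \<and> homogeneous p \<and> vars p \<subseteq> {..<length vs} \<and>
            subst_poly (\<lambda>i. vs ! i) p = 0) \<longleftrightarrow>
      (\<forall>d. mp.dim (pow_space V d) = (mp.dim V + d - 1) choose d)" if vs: "is_basis vs V" for vs
  proof -
    let ?S = "{..<length vs}"
    have gS: "(\<lambda>i. vs ! i) ` ?S = set vs" by (auto simp: set_conv_nth)
    have span: "V = mp.span ((\<lambda>i. vs ! i) ` ?S)" using vs unfolding gS is_basis_def by simp
    have "\<not> (\<exists>p :: (nat, 'k) mpoly. p \<noteq> 0 \<and> homogeneous p \<and> vars p \<subseteq> ?S \<and> subst_poly (\<lambda>i. vs ! i) p = 0)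
      \<longleftrightarrow> (\<forall>d. alg_indep_on (\<lambda>i. vs ! i) {m. keys m \<subseteq> ?S \<and> mdeg m = d})"
      unfolding alg_indep_on_def homogeneous_def vars_subset_iff by blast
    also have "\<dots> \<longleftrightarrow> (\<forall>d. mp.dim (pow_space V d) = (mp.dim V + d - 1) choose d)"
      by (simp add: alg_indep_on_iff_dim finite_monoms_eq card_monoms_eq
          pow_space_eq_span_monoms[OF span] is_basis_length[OF vs])
    finally show ?thesis .
  qed
  show ?thesis
  proof
    assume "hom_alg_independent V"
    then show "\<forall>d. mp.dim (pow_space V d) = (mp.dim V + d - 1) choose d"
      unfolding hom_alg_independent_def iff[OF ex, symmetric] using ex by (elim conjE allE impE)
  next
    assume *: "\<forall>d. mp.dim (pow_space V d) = (mp.dim V + d - 1) choose d"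
    show "hom_alg_independent V"
      unfolding hom_alg_independent_def by (intro conjI exI[of _ bs] ex allI impI iff[THEN iffD2, OF _ *])
  qed
qed

section \<open>Finite-dimensional spaces of polynomials\<close>

text \<open>The space of all polynomials is infinite-dimensional, so finite dimension of
  \<open>V\<close> is expressed by containment in the span of a finite set.\<close>

lemma mp_independent_bound:
  assumes "finite S" "V \<subseteq> mp.span S" "mp.independent B" "B \<subseteq> V"
  shows "finite B \<and> card B \<le> mp.dim (V :: ('v, 'k::field) mpoly set)"
proof -
  obtain C where C: "C \<subseteq> V" "mp.independent C" "V \<subseteq> mp.span C" "card C = mp.dim V"
    using mp.basis_exists[of V] by metis
  have "finite C" using mp.independent_span_bound[OF assms(1) C(2)] C(1) assms(2) by auto
  then show ?thesis using mp.independent_span_bound[of C B] C assms by auto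
qed

lemma mp_dim_mono:
  assumes "finite S" "V \<subseteq> mp.span S" "U \<subseteq> V"
  shows "mp.dim U \<le> mp.dim (V :: ('v, 'k::field) mpoly set)"
proof -
  obtain C where "C \<subseteq> U" "mp.independent C" "card C = mp.dim U"
    using mp.basis_exists[of U] by metis
  then show ?thesis using mp_independent_bound[OF assms(1,2), of C] assms(3) by auto
qed

text \<open>A vector of \<open>V\<close> outside the span could be added to \<open>B\<close>, giving
  an independent set larger than the dimension.\<close>

lemma mp_span_eq_if_card_ge_dim:
  assumes "finite S" "V \<subseteq> mp.span S" "mp.subspace V" "mp.independent B" "B \<subseteq> V" "mp.dim V \<le> card B"
  shows "mp.span B = (V :: ('v, 'k::field) mpoly set)"
proof
  show "mp.span B \<subseteq> V" using assms by (intro mp.span_minimal)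
  show "V \<subseteq> mp.span B"
  proof (rule ccontr)
    assume "\<not> V \<subseteq> mp.span B"
    then obtain v where v: "v \<in> V" "v \<notin> mp.span B" by auto
    have fin: "finite B" using mp_independent_bound[OF assms(1,2,4,5)] by simp
    have "mp.independent (insert v B)" using v assms(4) by (simp add: mp.independent_insertI)
    then have "card (insert v B) \<le> mp.dim V"
      using mp_independent_bound[OF assms(1,2), of "insert v B"] v assms(5) by auto
    moreover have "v \<notin> B" using v(2) by (auto intro: mp.span_base)
    ultimately show False using fin assms(6) by simp
  qed
qed

text \<open>The monomials of degree \<open>d\<close> in a basis of \<open>V\<close> span the
  power.\<close>

lemma dim_pow_space_le:
  fixes V :: "('v, 'k::field) mpoly set"
  assumes "mp.subspace V" "finite S" "V \<subseteq> mp.span S"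
  shows "mp.dim (pow_space V d) \<le> (mp.dim V + d - 1) choose d"
proof -
  obtain B where B: "B \<subseteq> V" "mp.independent B" "V \<subseteq> mp.span B" "card B = mp.dim V"
    using mp.basis_exists[of V] by metis
  have fin: "finite B" using mp_independent_bound[OF assms(2,3) B(2,1)] by simp
  have "V = mp.span ((\<lambda>b. b) ` B)"
    using B(3) mp.span_minimal[OF B(1) assms(1)] by simp
  note span = pow_space_eq_span_monoms[OF this, of d]
  let ?M = "{m. keys m \<subseteq> B \<and> mdeg m = d}"
  have "mp.dim (pow_space V d) \<le> card (monom_at (\<lambda>b. b) ` ?M)"
    unfolding span using fin by (intro mp.dim_le_card) (auto intro: finite_monoms_eq)
  also have "\<dots> \<le> card ?M" using fin by (intro card_image_le finite_monoms_eq)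
  also have "\<dots> = (mp.dim V + d - 1) choose d" using fin B(4) by (simp add: card_monoms_eq)
  finally show ?thesis .
qed

lemma pow_space_mono: "U \<subseteq> V \<Longrightarrow> pow_space U d \<subseteq> pow_space V d"
proof (induction d)
  case (Suc d)
  then show ?case unfolding pow_space.simps by (intro mp.span_mono) blast
qed simp

section \<open>Polynomials of bounded degree\<close>

definition deg_le :: "nat \<Rightarrow> ('v, 'k::zero) mpoly set" where
  "deg_le D = {p. \<forall>m\<in>keys p. mdeg m \<le> D}"

lemma subspace_deg_le: "mp.subspace (deg_le D :: ('v, 'k::field) mpoly set)"
proof (rule mp.subspaceI)
  fix p q :: "('v, 'k) mpoly" and c
  assume "p \<in> deg_le D"
  then show "scale c p \<in> deg_le D" by (auto simp: deg_le_def in_keys_iff)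
  assume "q \<in> deg_le D"
  with \<open>p \<in> deg_le D\<close> show "p + q \<in> deg_le D"
    using keys_add[of p q] by (auto simp: deg_le_def)
qed (simp add: deg_le_def)

lemma deg_le_subset_span:
  "(deg_le D :: ('v, 'k::field) mpoly set) \<subseteq> mp.span ((\<lambda>m. Poly_Mapping.single m 1) ` {m. mdeg m \<le> D})"
proof
  fix p :: "('v, 'k) mpoly" assume p: "p \<in> deg_le D"
  have "(\<Sum>m\<in>keys p. scale (lookup p m) (Poly_Mapping.single m 1))
      \<in> mp.span ((\<lambda>m. Poly_Mapping.single m 1) ` {m. mdeg m \<le> D})"
    using p by (intro mp.span_sum mp.span_scale mp.span_base) (auto simp: deg_le_def)
  then show "p \<in> mp.span ((\<lambda>m. Poly_Mapping.single m 1) ` {m. mdeg m \<le> D})"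
    using mpoly_sum_single[of "keys p" p] by simp
qed

lemma finite_deg_le: "finite ((\<lambda>m :: 'n::finite monom. Poly_Mapping.single m (1::'k::field)) ` {m. mdeg m \<le> D})"
  using finite_monoms_le[of "UNIV :: 'n set" D] by simp

lemma dim_deg_le_subset:
  assumes "V \<subseteq> (deg_le D :: ('n::finite, 'k::field) mpoly set)"
  shows "mp.dim V \<le> (CARD('n) + D) choose D"
proof -
  let ?M = "{m :: 'n monom. mdeg m \<le> D}"
  have "mp.dim V \<le> card ((\<lambda>m. Poly_Mapping.single m (1 :: 'k)) ` ?M)"
    using assms deg_le_subset_span by (intro mp.dim_le_card finite_deg_le) blast
  also have "\<dots> \<le> card ?M"
    using finite_monoms_le[of "UNIV :: 'n set" D] by (intro card_image_le) simp
  also have "\<dots> = (CARD('n) + D) choose D"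
    using card_monoms_le[of "UNIV :: 'n set" D] by simp
  finally show ?thesis .
qed

lemma partials_deg_le: "\<exists>D. partials (f :: ('n::finite, 'k::field) mpoly) \<subseteq> deg_le D"
proof (intro exI partials_minimal subspace_deg_le)
  show "f \<in> deg_le (Max (mdeg ` keys f))" by (auto simp: deg_le_def intro: Max_ge)
  fix i and g :: "('n, 'k) mpoly" assume g: "g \<in> deg_le (Max (mdeg ` keys f))"
  show "pd i g \<in> deg_le (Max (mdeg ` keys f))"
    unfolding deg_le_def
  proof (intro CollectI ballI)
    fix m assume "m \<in> keys (pd i g)"
    then have "m + Poly_Mapping.single i 1 \<in> keys g" by (auto simp: in_keys_iff lookup_pd)
    then have "mdeg (m + Poly_Mapping.single i 1) \<le> Max (mdeg ` keys f)"
      using g unfolding deg_le_def by blast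
    then show "mdeg m \<le> Max (mdeg ` keys f)" by (simp add: mdeg_add)
  qed
qed

lemma finite_span_partials: "\<exists>S. finite S \<and> partials (f :: ('n::finite, 'k::field) mpoly) \<subseteq> mp.span S"
  using partials_deg_le[of f] deg_le_subset_span finite_deg_le by (metis order_trans)

lemma pow_space_deg_le:
  assumes "V \<subseteq> (deg_le D :: ('v, 'k::field) mpoly set)"
  shows "pow_space V d \<subseteq> deg_le (d * D)"
proof (induction d)
  case 0
  show ?case
    unfolding pow_space.simps by (intro mp.span_minimal subspace_deg_le) (auto simp: deg_le_def)
next
  case (Suc d)
  show ?case
    unfolding pow_space.simps
  proof (intro mp.span_minimal subspace_deg_le, clarify)
    fix v g assume "v \<in> V" "g \<in> pow_space V d"
    then have vg: "v \<in> deg_le D" "g \<in> deg_le (d * D)" using assms Suc by auto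
    show "v * g \<in> deg_le (Suc d * D)"
      unfolding deg_le_def
    proof (intro CollectI ballI)
      fix m assume "m \<in> keys (v * g)"
      then obtain a b where "m = a + b" "a \<in> keys v" "b \<in> keys g" using keys_mult[of v g] by auto
      then show "mdeg m \<le> Suc d * D" using vg by (auto simp: deg_le_def mdeg_add intro!: add_mono)
    qed
  qed
qed

text \<open>
  More than \<open>n\<close> polynomials in \<open>n\<close> variables are algebraically dependent: the dimension of
  the span of their products of length at most \<open>d\<close> grows at most like \<open>d ^ n\<close>.
\<close>

lemma dim_le_if_dim_pow_space:
  fixes V :: "('n::finite, 'k::field) mpoly set"
  assumes V: "V \<subseteq> deg_le D"
    and dim: "\<And>d. mp.dim (pow_space V d) = (mp.dim V + d - 1) choose d"
  shows "mp.dim V \<le> CARD('n) + 1"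
proof (rule ccontr)
  assume "\<not> mp.dim V \<le> CARD('n) + 1"
  define n where "n = CARD('n)"
  \<comment> \<open>One more than \<open>n\<close>: a lower bound of order \<open>k\<close> in
    \<open>t\<close> will meet an upper bound of order \<open>n\<close>.\<close>
  define k where "k = n + 1"
  have k: "k > 0" "k + 1 \<le> mp.dim V"
    using \<open>\<not> mp.dim V \<le> CARD('n) + 1\<close> by (simp_all add: k_def n_def)
  have bound: "1 + t \<le> (k * (D + 1)) ^ n" for t
  proof -
    \<comment> \<open>A multiple of \<open>k\<close> makes (k + d) / k equal to 1 + t.\<close>
    define d where "d = k * t"
    have "real ((1 + t) ^ k) = (real (k + d) / real k) ^ k"
      using k(1) by (simp add: d_def add_divide_distrib)
    also have "\<dots> \<le> real ((k + d) choose k)"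
      by (rule binomial_ge_n_over_k_pow_k) simp
    finally have "(1 + t) ^ k \<le> (k + d) choose k" by linarith
    also have "\<dots> = (k + d) choose d" by (subst binomial_symmetric) simp_all
    also have "\<dots> \<le> (mp.dim V + d - 1) choose d" using k(2) by (intro binomial_right_mono) simp
    also have "\<dots> \<le> (n + d * D) choose (d * D)"
      unfolding dim[symmetric] n_def by (intro dim_deg_le_subset pow_space_deg_le V)
    also have "\<dots> = (n + d * D) choose n" by (subst binomial_symmetric) simp_all
    also have "\<dots> \<le> (n + d * D) ^ n" by (intro binomial_le_pow) simp
    also have "\<dots> \<le> (k * (D + 1) * (1 + t)) ^ n"
      by (intro power_mono) (simp_all add: d_def k_def algebra_simps)
    finally have "(1 + t) ^ k \<le> (k * (D + 1) * (1 + t)) ^ n" .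
    moreover have "(1 + t) ^ k = (1 + t) ^ n * (1 + t)" unfolding k_def by simp
    moreover have "(k * (D + 1) * (1 + t)) ^ n = (1 + t) ^ n * (k * (D + 1)) ^ n"
      by (simp only: power_mult_distrib mult_ac)
    ultimately have "(1 + t) ^ n * (1 + t) \<le> (1 + t) ^ n * (k * (D + 1)) ^ n" by simp
    then show ?thesis by (simp only: mult_le_cancel1) simp
  qed
  \<comment> \<open>The bound does not depend on \<open>t\<close>, so it can be inserted for
    \<open>t\<close> itself.\<close>
  from bound[of "(k * (D + 1)) ^ n"] show False by simp
qed

section \<open>Concise and encompassing polynomials\<close>

text \<open>The index type \<open>'n option\<close> is that of the coordinates in
  \<open>with_coord0\<close>.\<close>

definition low_monom :: "'n option \<Rightarrow> 'n monom" where
  "low_monom j = (case j of None \<Rightarrow> 0 | Some i \<Rightarrow> Poly_Mapping.single i 1)"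

lemma inj_low_monom: "inj low_monom"
proof (rule injI)
  fix j k :: "'a option" assume eq: "low_monom j = low_monom k"
  have l: "lookup (low_monom (Some i)) i' = (if i = i' then 1 else 0)" "lookup (low_monom None) i' = 0"
    for i i' :: 'a by (simp_all add: low_monom_def lookup_single when_def)
  show "j = k"
    using eq l by (cases j; cases k) (metis zero_neq_one option.inject)+
qed

lemma range_low_monom: "range low_monom = {m :: 'v monom. mdeg m \<le> 1}"
proof
  show "range low_monom \<subseteq> {m :: 'v monom. mdeg m \<le> 1}" by (auto simp: low_monom_def split: option.splits)
  show "{m :: 'v monom. mdeg m \<le> 1} \<subseteq> range low_monom"
  proof
    fix m :: "'v monom" assume "m \<in> {m. mdeg m \<le> 1}"
    then have le: "mdeg m \<le> Suc 0" by simp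
    show "m \<in> range low_monom"
    proof (cases "mdeg m = 0")
      case True
      then have "m = low_monom None" by (simp add: low_monom_def)
      then show ?thesis by blast
    next
      case False
      with le have "mdeg m = Suc 0" by linarith
      then obtain i m' where "m = m' + Poly_Mapping.single i 1" "mdeg m' = 0"
        using monom_cases[OF subset_UNIV] by metis
      then have "m = low_monom (Some i)" by (simp add: low_monom_def)
      then show ?thesis by blast
    qed
  qed
qed

definition low_partial :: "('n::finite, 'k::field) mpoly \<Rightarrow> 'n option \<Rightarrow> ('n, 'k) mpoly" where
  "low_partial f j = pdiff (low_monom j) f"

lemma low_partial_simps: "low_partial f None = f" "low_partial f (Some i) = pd i f"
  using pdiff_add_single[of 0 i f] by (simp_all add: low_partial_def low_monom_def)

lemma range_low_partial: "range (low_partial f) = insert f (range (\<lambda>i. pd i f))"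
  by (simp add: UNIV_option_conv image_image low_partial_simps)

lemma low_partial_in_partials: "range (low_partial f) \<subseteq> partials f"
  by (auto simp: low_partial_def pdiff_in_partials)

text \<open>A linear relation between \<open>f\<close> and its first derivatives is an operator of
  degree at most 1 that annihilates \<open>f\<close>.\<close>

lemma concise_low_partial_zero:
  fixes f :: "('n::finite, 'k::field) mpoly"
  assumes "concise f" and zero: "(\<Sum>j\<in>UNIV. scale (c j) (low_partial f j)) = 0"
  shows "c j = 0"
proof -
  define \<sigma> where "\<sigma> = (\<Sum>j\<in>UNIV. Poly_Mapping.single (low_monom j) (c j) :: ('n, 'k) mpoly)"
  have "act \<sigma> f = 0"
    unfolding \<sigma>_def mpp.linear_sum[OF act_linear_left] using zero by (simp add: low_partial_def)
  moreover have "mdeg m \<le> 1" if "m \<in> keys \<sigma>" for m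
  proof -
    have "m \<in> range low_monom"
    proof (rule ccontr)
      assume "m \<notin> range low_monom"
      then have "lookup \<sigma> m = 0"
        unfolding \<sigma>_def lookup_sum by (intro sum.neutral) (auto simp: lookup_single when_def)
      with that show False by (simp add: in_keys_iff)
    qed
    then show ?thesis unfolding range_low_monom by simp
  qed
  then have "total_degree \<sigma> \<le> 1" by (auto simp: total_degree_def)
  ultimately have "\<sigma> = 0" using assms(1) by (auto simp: concise_def Ann_def)
  moreover have "lookup \<sigma> (low_monom j) = (\<Sum>i\<in>UNIV. if i = j then c i else 0)"
    unfolding \<sigma>_def lookup_sum
    by (intro sum.cong) (auto simp: lookup_single when_def inj_eq[OF inj_low_monom])
  ultimately show ?thesis by simp
qed

lemma concise_low_partial:
  fixes f :: "('n::finite, 'k::field) mpoly"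
  assumes "concise f"
  shows "inj (low_partial f)" "mp.independent (range (low_partial f))"
proof -
  show "inj (low_partial f)"
  proof (rule mp_family_independent(1)[OF finite])
    fix c j assume "(\<Sum>j\<in>UNIV. scale (c j) (low_partial f j)) = 0"
    then show "c j = 0" by (rule concise_low_partial_zero[OF assms])
  qed
  show "mp.independent (range (low_partial f))"
  proof (rule mp_family_independent(2)[OF finite])
    fix c j assume "(\<Sum>j\<in>UNIV. scale (c j) (low_partial f j)) = 0"
    then show "c j = 0" by (rule concise_low_partial_zero[OF assms])
  qed
qed

lemma card_range_low_partial:
  assumes "concise (f :: ('n::finite, 'k::field) mpoly)"
  shows "card (range (low_partial f)) = CARD('n) + 1"
  using card_image[OF concise_low_partial(1)[OF assms]] by simp

lemma concise_neq_0:
  assumes "concise (f :: ('n::finite, 'k::field) mpoly)"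
  shows "f \<noteq> 0"
proof
  assume "f = 0"
  then have "0 \<in> range (low_partial f)" using range_low_partial[of f] by auto
  then show False using concise_low_partial(2)[OF assms] mp.dependent_zero by blast
qed

lemma concise_dim_ge:
  assumes "concise (f :: ('n::finite, 'k::field) mpoly)"
  shows "CARD('n) + 1 \<le> mp.dim (partials f)"
  using finite_span_partials[of f] mp_independent_bound[of _ "partials f" "range (low_partial f)"]
    concise_low_partial(2)[OF assms] low_partial_in_partials[of f] card_range_low_partial[OF assms]
  by metis

lemma concise_span_low_partial:
  assumes "concise (f :: ('n::finite, 'k::field) mpoly)" "mp.dim (partials f) = CARD('n) + 1"
  shows "mp.span (range (low_partial f)) = partials f"
proof -
  obtain S where "finite S" "partials f \<subseteq> mp.span S" using finite_span_partials by blast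
  then show ?thesis
    using concise_low_partial(2)[OF assms(1)] low_partial_in_partials[of f]
      card_range_low_partial[OF assms(1)] assms(2) subspace_partials[of f]
    by (intro mp_span_eq_if_card_ge_dim[of S]) simp_all
qed

lemma lookup_deg_le_part: "lookup (deg_le_part d p) m = (if mdeg m \<le> d then lookup p m else 0)"
proof -
  have "lookup (deg_le_part d p) m = (\<Sum>k\<in>{k \<in> keys p. mdeg k \<le> d}. if k = m then lookup p m else 0)"
    unfolding deg_le_part_def lookup_sum by (intro sum.cong) (auto simp: lookup_single when_def)
  also have "\<dots> = (if mdeg m \<le> d then lookup p m else 0)"
    by (auto simp: in_keys_iff)
  finally show ?thesis .
qed

text \<open>Write \<open>g = act \<tau> f\<close>. As operators commute, constant terms of
  derivatives of \<open>g\<close> are those of \<open>act \<tau>\<close> at partials of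
  \<open>f\<close>. At low partials they are multiples of low coefficients of \<open>g\<close>,
  hence zero; the span hypothesis extends this to all partials.\<close>

lemma encompassing_if_span_low_partial:
  fixes f :: "('n::finite, 'k::field_char_0) mpoly"
  assumes V: "mp.span (range (low_partial f)) = partials f"
  shows "encompassing f"
  unfolding encompassing_def
proof (intro notI, elim bexE conjE)
  fix g assume g: "g \<in> partials f" "g \<noteq> 0" "deg_le_part 1 g = 0"
  then obtain \<tau> where \<tau>: "g = act \<tau> f" by (auto simp: partials_def)
  have low: "lookup g (low_monom j) = 0" for j
  proof -
    have "mdeg (low_monom j) \<le> 1" using range_low_monom by blast
    then show ?thesis using g(3) lookup_deg_le_part[of 1 g "low_monom j"] by simp
  qed
  have act_pdiff: "act \<tau> (pdiff a f) = pdiff a g" for a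
    using act_commute[of \<tau> "Poly_Mapping.single a 1" f] by (simp add: \<tau>)
  let ?W = "{h. lookup (act \<tau> h) 0 = 0}"
  have "mp.subspace ?W"
    unfolding mp.subspace_def
    by (auto simp: mpp.linear_add[OF act_linear] mpp.linear_scale[OF act_linear] lookup_add)
  moreover have "range (low_partial f) \<subseteq> ?W"
  proof clarify
    fix j
    obtain c where "\<forall>p :: ('n, 'k) mpoly. lookup (pdiff (low_monom j) p) 0 = of_nat c * lookup p (0 + low_monom j)"
      using lookup_pdiff by blast
    then show "lookup (act \<tau> (low_partial f j)) 0 = 0"
      by (simp add: low_partial_def act_pdiff low)
  qed
  ultimately have "partials f \<subseteq> ?W" unfolding V[symmetric] by (intro mp.span_minimal)
  then have "lookup (pdiff a g) 0 = 0" for a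
    using pdiff_in_partials[of a f] act_pdiff by auto
  then have "g = 0" by (rule mpoly_eq_0_if_pdiff_const_0)
  with g(2) show False by simp
qed

lemma deg_le_part_linear: "mp_linear (deg_le_part d)"
  by (rule mp_linearI; rule poly_mapping_eqI) (auto simp: lookup_deg_le_part lookup_add)

text \<open>Truncation to degree at most 1 is injective on the partials, and its target has
  dimension at most n + 1. If the dimensions agree it is onto, so every variable is the truncation
  of a partial.\<close>

lemma encompassing_lowest_terms:
  fixes f :: "('n::finite, 'k::field) mpoly"
  assumes "encompassing f"
  shows "mp.dim (partials f) \<le> CARD('n) + 1"
    and "mp.dim (partials f) = CARD('n) + 1 \<Longrightarrow>
      \<exists>v\<in>partials f. deg_le_part 1 v = Poly_Mapping.single (Poly_Mapping.single i 1) 1"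
proof -
  let ?T = "deg_le_part 1 :: ('n, 'k) mpoly \<Rightarrow> _" and ?V = "partials f"
  let ?X = "\<lambda>j :: 'n option. Poly_Mapping.single (low_monom j) (1::'k)"
  obtain S where S: "finite S" "?V \<subseteq> mp.span S" using finite_span_partials by blast
  obtain B where B: "B \<subseteq> ?V" "mp.independent B" "?V \<subseteq> mp.span B" "card B = mp.dim ?V"
    using mp.basis_exists[of ?V] by metis
  have span: "mp.span B = ?V" using B mp.span_minimal[OF B(1) subspace_partials] by auto
  have inj: "inj_on ?T ?V"
  proof (rule inj_onI)
    fix g h assume gh: "g \<in> ?V" "h \<in> ?V" "?T g = ?T h"
    then have "g - h \<in> ?V" "?T (g - h) = 0"
      by (simp_all add: mp.subspace_diff subspace_partials mpp.linear_diff[OF deg_le_part_linear])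
    then show "g = h" using assms by (auto simp: encompassing_def)
  qed
  have ind: "mp.independent (?T ` B)"
    using inj B(2) by (intro mpp.linear_independent_injective_image[OF deg_le_part_linear]) (simp_all add: span)
  have card: "card (?T ` B) = mp.dim ?V"
    using inj B(1,4) by (metis card_image inj_on_subset)
  have "?T g \<in> mp.span (range ?X)" for g
  proof -
    have "?T g \<in> deg_le 1"
      by (auto simp: deg_le_def in_keys_iff lookup_deg_le_part split: if_splits)
    then have "?T g \<in> mp.span ((\<lambda>m. Poly_Mapping.single m 1) ` range low_monom)"
      unfolding range_low_monom using deg_le_subset_span by blast
    then show ?thesis by (simp add: image_image)
  qed
  then have sub: "?T ` B \<subseteq> mp.span (range ?X)" by blast
  have X: "card (range ?X) \<le> CARD('n) + 1"
    using card_image_le[of "UNIV :: 'n option set" ?X] by simp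
  have fin: "finite (range ?X)" by simp
  show dim: "mp.dim ?V \<le> CARD('n) + 1"
    using mp.independent_span_bound[OF fin ind sub] card X by simp
  show "\<exists>v\<in>?V. ?T v = Poly_Mapping.single (Poly_Mapping.single i 1) 1"
    if "mp.dim ?V = CARD('n) + 1"
  proof -
    have "mp.dim (mp.span (range ?X)) \<le> card (range ?X)"
      by (intro mp.dim_le_card fin) simp
    then have "mp.span (?T ` B) = mp.span (range ?X)"
      using X card that sub ind by (intro mp_span_eq_if_card_ge_dim[OF fin]) auto
    then have "?X (Some i) \<in> ?T ` ?V"
      unfolding mpp.linear_span_image[OF deg_le_part_linear] span by (auto intro: mp.span_base)
    then show ?thesis by (auto simp: low_monom_def)
  qed
qed

section \<open>Orders and lowest terms\<close>

definition order_ge :: "nat \<Rightarrow> ('v, 'k::zero) mpoly \<Rightarrow> bool" where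
  "order_ge k p \<longleftrightarrow> (\<forall>m\<in>keys p. k \<le> mdeg m)"

lemma order_ge_mult:
  assumes "order_ge j p" "order_ge k (q :: ('v, 'k::field) mpoly)"
  shows "order_ge (j + k) (p * q)"
  using assms keys_mult[of p q] unfolding order_ge_def
  by (force simp: mdeg_add intro: add_mono)

lemma order_ge_add:
  assumes "order_ge k p" "order_ge k (q :: ('v, 'k::field) mpoly)"
  shows "order_ge k (p + q)"
  using assms keys_add[of p q] unfolding order_ge_def by blast

text \<open>
  Since the \<open>v i\<close> have the variables as terms of lowest degree, the terms of lowest degree of a
  polynomial in the \<open>v i\<close> are those of the polynomial itself.
\<close>

lemma alg_indep_on_lowest_terms:
  fixes v :: "'n \<Rightarrow> ('n::finite, 'k::field) mpoly"
  assumes v: "\<And>i. deg_le_part 1 (v i) = Poly_Mapping.single (Poly_Mapping.single i 1) 1"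
  shows "alg_indep_on v UNIV"
proof -
  let ?X = "\<lambda>m. Poly_Mapping.single m (1 :: 'k)"
  have v_order: "order_ge 2 (v i - ?X (Poly_Mapping.single i 1))" for i
  proof -
    have "lookup (v i - ?X (Poly_Mapping.single i 1)) m = 0" if "mdeg m \<le> 1" for m
      using that lookup_deg_le_part[of 1 "v i" m] unfolding v by (simp add: lookup_minus)
    then show ?thesis unfolding order_ge_def by (force simp: in_keys_iff)
  qed
  have order: "order_ge (mdeg a) (?X a)" for a :: "'n monom" by (simp add: order_ge_def)
  \<comment> \<open>Each product of the \<open>v i\<close> is the corresponding monomial plus terms
    of strictly higher degree; the induction replaces one factor at a time.\<close>
  have monom: "order_ge (mdeg a + 1) (monom_at v a - ?X a)" for a
  proof (induction a rule: monom_induct)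
    case zero
    show ?case by (simp add: order_ge_def)
  next
    case (add a i)
    let ?e = "Poly_Mapping.single i (1::nat)"
    have "monom_at v a = ?X a + (monom_at v a - ?X a)" by simp
    moreover have "order_ge (mdeg a) (monom_at v a - ?X a)"
      using add by (auto simp: order_ge_def)
    ultimately have "order_ge (mdeg a) (monom_at v a)"
      using order_ge_add[OF order] by metis
    then have "order_ge (mdeg a + 2) (monom_at v a * (v i - ?X ?e))"
      using v_order by (intro order_ge_mult)
    moreover have "order_ge ((mdeg a + 1) + 1) ((monom_at v a - ?X a) * ?X ?e)"
      using add order[of ?e] by (intro order_ge_mult) simp_all
    ultimately have "order_ge (mdeg a + 2)
        (monom_at v a * (v i - ?X ?e) + (monom_at v a - ?X a) * ?X ?e)"
      by (intro order_ge_add) simp_all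
    moreover have "monom_at v a * (v i - ?X ?e) + (monom_at v a - ?X a) * ?X ?e
        = monom_at v (a + ?e) - ?X (a + ?e)"
      by (simp add: monom_at_add algebra_simps mult_single)
    ultimately show ?case by (simp add: mdeg_add)
  qed
  show ?thesis
    unfolding alg_indep_on_def
  proof (intro allI impI, rule ccontr)
    fix p assume p: "subst_poly v p = 0" "p \<noteq> 0"
    then have "keys p \<noteq> {}" by simp
    \<comment> \<open>At an exponent of least degree, no other exponent of \<open>p\<close> can
      contribute to the coefficient.\<close>
    then obtain a where a: "a \<in> keys p" "\<And>b. b \<in> keys p \<Longrightarrow> mdeg a \<le> mdeg b"
      using ex_min_if_finite[of "mdeg ` keys p"] by (metis arg_min_least finite_keys arg_min_if_finite(1))
    have "lookup (monom_at v b) a = (if b = a then 1 else 0)" if b: "b \<in> keys p" for b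
    proof -
      have "a \<notin> keys (monom_at v b - ?X b)"
        using monom[of b] a(2)[OF b] by (auto simp: order_ge_def)
      then have "lookup (monom_at v b) a = lookup (?X b) a" by (simp add: in_keys_iff lookup_minus)
      then show ?thesis by (simp add: lookup_single when_def)
    qed
    then have "lookup (subst_poly v p) a = (\<Sum>b\<in>keys p. if b = a then lookup p b else 0)"
      unfolding subst_poly_superset[OF finite_keys order_refl] lookup_sum by (intro sum.cong) auto
    also have "\<dots> = lookup p a" using a(1) by simp
    finally show False using p(1) a(1) by (simp add: in_keys_iff)
  qed
qed

section \<open>Equivalence of the conditions\<close>

lemma concise_dim_Ap_power:
  fixes f :: "('n::finite, 'k::field_char_0) mpoly"
  assumes "concise f"
  shows "dim_Ap (f ^ d) = mp.dim (partials (f ^ d))"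
  using finite_span_partials[of "f ^ d"] mpoly_power_neq_0[OF concise_neq_0[OF assms]]
  by (metis dim_Ap_eq)

text \<open>The subspace spanned by 1 and partials with the variables as lowest terms already has
  powers of the required dimension; the general upper bound does the rest.\<close>

lemma dim_pow_space_if_encompassing:
  fixes f :: "('n::finite, 'k::field) mpoly"
  assumes enc: "encompassing f" and dim: "mp.dim (partials f) = CARD('n) + 1"
    and one: "1 \<in> partials f"
  shows "mp.dim (pow_space (partials f) d) = (mp.dim (partials f) + d - 1) choose d"
proof -
  let ?V = "partials f"
  obtain S where S: "finite S" "?V \<subseteq> mp.span S" using finite_span_partials by blast
  have "\<forall>i. \<exists>v\<in>?V. deg_le_part 1 v = Poly_Mapping.single (Poly_Mapping.single i 1) 1"
    using encompassing_lowest_terms(2)[OF enc dim] by blast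
  then obtain v where v: "v i \<in> ?V" "deg_le_part 1 (v i) = Poly_Mapping.single (Poly_Mapping.single i 1) 1"
    for i by metis
  let ?W = "mp.span (insert 1 (range v))"
  have "alg_indep_on v {m. keys m \<subseteq> UNIV}"
    using alg_indep_on_lowest_terms[OF v(2)] by simp
  then have W: "mp.dim (pow_space ?W d) = (CARD('n) + d) choose d"
    using alg_indep_on_iff_dim_pow_space[of UNIV v] by simp
  have "?W \<subseteq> ?V" using one v(1) by (intro mp.span_minimal subspace_partials) auto
  then have sub: "pow_space ?W d \<subseteq> pow_space ?V d" by (rule pow_space_mono)
  obtain D where "?V \<subseteq> deg_le D" using partials_deg_le by blast
  then have "pow_space ?V d \<subseteq> mp.span ((\<lambda>m. Poly_Mapping.single m 1) ` {m. mdeg m \<le> d * D})"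
    using pow_space_deg_le deg_le_subset_span by (metis order_trans)
  then have "mp.dim (pow_space ?W d) \<le> mp.dim (pow_space ?V d)"
    using sub by (rule mp_dim_mono[OF finite_deg_le])
  moreover have "mp.dim (pow_space ?V d) \<le> (mp.dim ?V + d - 1) choose d"
    by (rule dim_pow_space_le[OF subspace_partials S])
  ultimately show ?thesis using W dim by simp
qed

lemma set_map_conv_nth: "set (map F xs) = (\<lambda>i. F (xs ! i)) ` {..<length xs}"
  unfolding set_map set_conv_nth[of xs] by auto

context
  fixes f :: "('n::finite, 'k::field_char_0) mpoly"
  assumes concise: "concise f"
begin

text \<open>In dimension n + 1 the low partials span. Conversely, conciseness bounds the dimension
  from below and truncation from above.\<close>

lemma dim_eq_iff_encompassing: "mp.dim (partials f) = CARD('n) + 1 \<longleftrightarrow> encompassing f"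
proof
  assume "mp.dim (partials f) = CARD('n) + 1"
  then show "encompassing f"
    by (rule encompassing_if_span_low_partial[OF concise_span_low_partial[OF concise]])
next
  assume "encompassing f"
  then show "mp.dim (partials f) = CARD('n) + 1"
    using encompassing_lowest_terms(1) concise_dim_ge[OF concise] by (intro order_antisym)
qed

lemma dim_pow_space_iff_dim_eq:
  "(\<forall>d. mp.dim (pow_space (partials f) d) = (mp.dim (partials f) + d - 1) choose d) \<longleftrightarrow>
    mp.dim (partials f) = CARD('n) + 1"
proof
  assume *: "\<forall>d. mp.dim (pow_space (partials f) d) = (mp.dim (partials f) + d - 1) choose d"
  obtain D where "partials f \<subseteq> deg_le D" using partials_deg_le by blast
  then have "mp.dim (partials f) \<le> CARD('n) + 1" using * by (intro dim_le_if_dim_pow_space) auto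
  then show "mp.dim (partials f) = CARD('n) + 1" using concise_dim_ge[OF concise] by simp
next
  assume dim: "mp.dim (partials f) = CARD('n) + 1"
  then have "encompassing f" by (rule dim_eq_iff_encompassing[THEN iffD1])
  then show "\<forall>d. mp.dim (pow_space (partials f) d) = (mp.dim (partials f) + d - 1) choose d"
    using dim_pow_space_if_encompassing dim one_in_partials[OF concise_neq_0[OF concise]] by blast
qed

text \<open>The partials of \<open>f ^ d\<close> lie in the power of \<open>partials f\<close>, so
  maximal growth forces the power to attain its upper bound. Conversely the dimension is n + 1, the
  low partials span, and the partials of \<open>f ^ d\<close> fill the power.\<close>

lemma maximal_growth_iff_dim_pow_space:
  "maximal_growth f \<longleftrightarrow>
    (\<forall>d. mp.dim (pow_space (partials f) d) = (mp.dim (partials f) + d - 1) choose d)"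
proof -
  let ?V = "partials f"
  obtain S where S: "finite S" "?V \<subseteq> mp.span S" using finite_span_partials by blast
  have growth: "maximal_growth f \<longleftrightarrow>
      (\<forall>d\<ge>1. mp.dim (partials (f ^ d)) = (mp.dim ?V + d - 1) choose d)"
    using concise_dim_Ap_power[OF concise] concise_dim_Ap_power[OF concise, of 1]
    by (simp add: maximal_growth_def)
  show ?thesis
  proof
    assume g: "maximal_growth f"
    show "\<forall>d. mp.dim (pow_space ?V d) = (mp.dim ?V + d - 1) choose d"
    proof
      fix d
      show "mp.dim (pow_space ?V d) = (mp.dim ?V + d - 1) choose d"
      \<comment> \<open>Maximal growth only speaks of positive \<open>d\<close>; in degree 0 the
        power is the line of constants.\<close>
      proof (cases "d = 0")
        case True
        have "mp.dim {1 :: ('n, 'k) mpoly} = card {1 :: ('n, 'k) mpoly}"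
          by (rule mp.dim_eq_card_independent) simp
        then show ?thesis using True by simp
      next
        case False
        obtain D where "?V \<subseteq> deg_le D" using partials_deg_le by blast
        then have "pow_space ?V d \<subseteq> mp.span ((\<lambda>m. Poly_Mapping.single m 1) ` {m. mdeg m \<le> d * D})"
          using pow_space_deg_le deg_le_subset_span by (metis order_trans)
        then have "mp.dim (partials (f ^ d)) \<le> mp.dim (pow_space ?V d)"
          using partials_power_subset by (rule mp_dim_mono[OF finite_deg_le])
        moreover have "mp.dim (partials (f ^ d)) = (mp.dim ?V + d - 1) choose d"
          using g False unfolding growth by simp
        moreover have "mp.dim (pow_space ?V d) \<le> (mp.dim ?V + d - 1) choose d"
          by (rule dim_pow_space_le[OF subspace_partials S])
        ultimately show ?thesis by simp
      qed
    qed
  next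
    assume *: "\<forall>d. mp.dim (pow_space ?V d) = (mp.dim ?V + d - 1) choose d"
    then have "mp.dim ?V = CARD('n) + 1" unfolding dim_pow_space_iff_dim_eq .
    then have "?V = mp.span (insert f (range (\<lambda>i. pd i f)))"
      using concise_span_low_partial[OF concise] range_low_partial[of f] by simp
    then have "partials (f ^ d) = pow_space ?V d" for d by (rule partials_power_eq)
    then show "maximal_growth f" using * unfolding growth by simp
  qed
qed

lemma hom_alg_independent_partials_iff:
  "hom_alg_independent (partials f) \<longleftrightarrow>
    (\<forall>d. mp.dim (pow_space (partials f) d) = (mp.dim (partials f) + d - 1) choose d)"
  using finite_span_partials[of f] by (elim exE conjE) (rule hom_alg_independent_iff[OF subspace_partials])

lemma dominant_total_grad_iff_dim_pow_space:
  assumes as: "total_grad_indices f as"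
  shows "dominant (length as) (total_grad f as) \<longleftrightarrow>
    (\<forall>d. mp.dim (pow_space (partials f) d) = (mp.dim (partials f) + d - 1) choose d)"
proof -
  have basis: "is_basis (1 # map (\<lambda>a. pdiff a f) as) (partials f)"
    using as by (simp add: total_grad_indices_def)
  have "set (map (\<lambda>a. pdiff a f) as) = (\<lambda>i. pdiff (as ! i) f) ` {..<length as}"
    by (rule set_map_conv_nth)
  then have span: "mp.span (insert 1 ((\<lambda>i. pdiff (as ! i) f) ` {..<length as})) = partials f"
    using basis by (simp add: is_basis_def)
  \<comment> \<open>The basis has the extra vector 1, so the count for \<open>length as\<close>
    elements in degree at most \<open>d\<close> is the one for the whole basis in degree exactly
    \<open>d\<close>.\<close>
  have "mp.dim (partials f) = length as + 1"
    using is_basis_length[OF basis] by simp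
  then show ?thesis
    unfolding dominant_total_grad_iff alg_indep_on_iff_dim_pow_space[OF finite_lessThan] span
    by simp
qed

end

section \<open>Total gradient maps\<close>

text \<open>Extending 1 to a basis within the generators \<open>pdiff a f\<close> leaves only
  members that come from multi-indices.\<close>

lemma ex_total_grad_indices:
  fixes f :: "('n::finite, 'k::field_char_0) mpoly"
  assumes "concise f"
  shows "\<exists>as. total_grad_indices f as"
proof -
  let ?V = "partials f" and ?P = "range (\<lambda>a. pdiff a f)"
  have one: "1 \<in> ?V" by (rule one_in_partials[OF concise_neq_0[OF assms]])
  have sub: "{1} \<subseteq> insert 1 ?P" and ind: "mp.independent {1 :: ('n, 'k) mpoly}" by simp_all
  obtain B where B: "{1} \<subseteq> B" "B \<subseteq> insert 1 ?P" "mp.independent B" "insert 1 ?P \<subseteq> mp.span B"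
    by (rule mp.maximal_independent_subset_extend[OF sub ind])
  have "B \<subseteq> ?V" using B(2) one pdiff_in_partials by blast
  moreover have "?V \<subseteq> mp.span B"
    unfolding partials_eq_span using B(4) by (intro mp.span_minimal) auto
  ultimately have span: "mp.span B = ?V"
    by (intro equalityI mp.span_minimal subspace_partials)
  obtain S where "finite S" "?V \<subseteq> mp.span S" using finite_span_partials by blast
  then have fin: "finite B" using mp_independent_bound[OF _ _ B(3) \<open>B \<subseteq> ?V\<close>] by blast
  obtain bs where bs: "set bs = B - {1}" "distinct bs" using finite_distinct_list[of "B - {1}"] fin by auto
  define as where "as = map (\<lambda>b. SOME a. pdiff a f = b) bs"
  have "pdiff (SOME a. pdiff a f = b) f = b" if "b \<in> set bs" for b
  proof -
    from that obtain a where "pdiff a f = b" using bs(1) B(2) by auto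
    then show ?thesis by (rule someI)
  qed
  then have map: "map (\<lambda>a. pdiff a f) as = bs" by (simp add: as_def map_idI)
  have basis: "is_basis (1 # bs) ?V"
    using bs B(1,3) span by (auto simp: is_basis_def insert_absorb)
  have "dim_Ap f = mp.dim ?V" using concise_dim_Ap_power[OF assms, of 1] by simp
  then have "length as = dim_Ap f - 1"
    using is_basis_length[OF basis] by (simp add: as_def)
  then show ?thesis using basis map by (auto simp: total_grad_indices_def)
qed

lemma span_range_expand:
  fixes h :: "'j::finite \<Rightarrow> ('v, 'k::field) mpoly"
  assumes "inj h" "x \<in> mp.span (range h)"
  shows "\<exists>c. x = (\<Sum>j\<in>UNIV. scale (c j) (h j))"
proof -
  from assms(2) obtain c where "x = (\<Sum>y\<in>range h. scale (c y) y)"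
    by (auto simp: mp.span_finite)
  then have "x = (\<Sum>j\<in>UNIV. scale (c (h j)) (h j))"
    using assms(1) by (simp add: sum.reindex)
  then show ?thesis by (rule exI[of _ "\<lambda>j. c (h j)"])
qed

text \<open>Inserting one expansion into the other expands \<open>u j\<close> in the family
  \<open>u\<close> itself, where coefficients are unique.\<close>

lemma change_of_basis_mult:
  fixes h u :: "'j::finite \<Rightarrow> ('v, 'k::field) mpoly" and M N :: "'k ^ 'j ^ 'j"
  assumes u: "inj u" "mp.independent (range u)"
    and M: "\<And>j. u j = (\<Sum>k\<in>UNIV. scale (M $ j $ k) (h k))"
    and N: "\<And>j. h j = (\<Sum>k\<in>UNIV. scale (N $ j $ k) (u k))"
  shows "M ** N = mat 1"
proof -
  have "(M ** N) $ j $ i - mat 1 $ j $ i = 0" for i j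
  proof (rule mp_family_scalars_zero[OF _ u, where c = "\<lambda>i. (M ** N) $ j $ i - mat 1 $ j $ i"])
    have "(\<Sum>i\<in>UNIV. scale ((M ** N) $ j $ i) (u i))
        = (\<Sum>i\<in>UNIV. \<Sum>k\<in>UNIV. scale (M $ j $ k) (scale (N $ k $ i) (u i)))"
      by (simp add: matrix_matrix_mult_def mp.scale_sum_left)
    also have "\<dots> = (\<Sum>k\<in>UNIV. scale (M $ j $ k) (h k))"
      by (subst sum.swap) (simp add: N[symmetric] mp.scale_sum_right[symmetric] del: mp.scale_scale)
    also have "\<dots> = u j" by (rule M[symmetric])
    also have "\<dots> = (\<Sum>i\<in>UNIV. if i = j then u i else 0)" by simp
    also have "\<dots> = (\<Sum>i\<in>UNIV. scale (mat 1 $ j $ i) (u i))"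
      by (intro sum.cong) (auto simp: mat_def)
    finally show "(\<Sum>i\<in>UNIV. scale ((M ** N) $ j $ i - mat 1 $ j $ i) (u i)) = 0"
      by (simp add: mp.scale_left_diff_distrib sum_subtractf)
  qed auto
  then show ?thesis by (simp add: vec_eq_iff)
qed

lemma change_of_basis:
  fixes h u :: "'j::finite \<Rightarrow> ('v, 'k::field) mpoly"
  assumes h: "inj h" "mp.independent (range h)" and u: "inj u" "mp.independent (range u)"
    and span: "mp.span (range h) = mp.span (range u)"
  shows "\<exists>M :: 'k ^ 'j ^ 'j. invertible M \<and> (\<forall>j. u j = (\<Sum>k\<in>UNIV. scale (M $ j $ k) (h k)))"
proof -
  have "\<forall>j. \<exists>c. u j = (\<Sum>k\<in>UNIV. scale (c k) (h k))"
    using span by (intro allI span_range_expand[OF h(1)]) (auto intro: mp.span_base)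
  then obtain m where m: "\<And>j. u j = (\<Sum>k\<in>UNIV. scale (m j k) (h k))" by metis
  have "\<forall>j. \<exists>c. h j = (\<Sum>k\<in>UNIV. scale (c k) (u k))"
    using span by (intro allI span_range_expand[OF u(1)]) (metis mp.span_base rangeI)
  then obtain n where n: "\<And>j. h j = (\<Sum>k\<in>UNIV. scale (n j k) (u k))" by metis
  define M :: "'k ^ 'j ^ 'j" where "M = (\<chi> j k. m j k)"
  define N :: "'k ^ 'j ^ 'j" where "N = (\<chi> j k. n j k)"
  have M: "u j = (\<Sum>k\<in>UNIV. scale (M $ j $ k) (h k))" for j unfolding M_def by (simp add: m)
  have N: "h j = (\<Sum>k\<in>UNIV. scale (N $ j $ k) (u k))" for j unfolding N_def by (simp add: n)
  have "M ** N = mat 1" "N ** M = mat 1"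
    using change_of_basis_mult[OF u M N] change_of_basis_mult[OF h N M] by simp_all
  then have "invertible M" unfolding invertible_def by blast
  with M show ?thesis by (intro exI[of _ M]) simp
qed

text \<open>In dimension n + 1, both 1 with the components of the total gradient and
  \<open>f\<close> with its first derivatives are bases of the partials. The matrix between them is
  constant, so the relation survives evaluation at every point.\<close>

lemma total_grad_coord_change:
  fixes f :: "('n::finite, 'k::field_char_0) mpoly"
  assumes f: "concise f" and as: "total_grad_indices f as"
    and dim: "mp.dim (partials f) = CARD('n) + 1"
  shows "\<exists>e :: 'n \<Rightarrow> nat. bij_betw e UNIV {..<length as} \<and>
    equal_up_to_coord_change
      (\<lambda>x. with_coord0 1 (\<lambda>i. total_grad f as x (e i)))
      (\<lambda>x. with_coord0 (eval_at x f) (grad f x))"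
proof -
  have basis: "is_basis (1 # map (\<lambda>a. pdiff a f) as) (partials f)"
    using as by (simp add: total_grad_indices_def)
  have len: "length as = CARD('n)" using is_basis_length[OF basis] dim by simp
  \<comment> \<open>Only a numbering of the variables: the total gradient is indexed by naturals,
    the gradient by \<open>'n\<close>.\<close>
  obtain e where e: "bij_betw e (UNIV :: 'n set) {..<length as}"
    using ex_bij_betw_finite_nat[of "UNIV :: 'n set"] len by (auto simp: atLeast0LessThan)
  then have e_lt: "e i < length as" for i by (auto dest: bij_betwE)
  define u where "u = (\<lambda>j :: 'n option. case j of None \<Rightarrow> 1 | Some i \<Rightarrow> pdiff (as ! e i) f)"
  have "range (\<lambda>i. pdiff (as ! e i) f) = (\<lambda>k. pdiff (as ! k) f) ` {..<length as}"
    unfolding bij_betw_imp_surj_on[OF e, symmetric] image_image ..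
  also have "\<dots> = set (map (\<lambda>a. pdiff a f) as)" by (rule set_map_conv_nth[symmetric])
  finally have range_u: "range u = set (1 # map (\<lambda>a. pdiff a f) as)"
    by (simp add: UNIV_option_conv image_image u_def)
  have u_span: "mp.span (range u) = partials f" and u_ind: "mp.independent (range u)"
    using basis unfolding range_u is_basis_def by auto
  have "card (range u) = CARD('n option)"
    using mp.dim_span_eq_card_independent[OF u_ind] u_span dim by simp
  then have u_inj: "inj u" by (simp add: eq_card_imp_inj_on)
  have "mp.span (range (low_partial f)) = mp.span (range u)"
    using concise_span_low_partial[OF f dim] u_span by simp
  then have "\<exists>M :: 'k ^ 'n option ^ 'n option. invertible M \<and>
      (\<forall>j. u j = (\<Sum>k\<in>UNIV. scale (M $ j $ k) (low_partial f k)))"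
    by (rule change_of_basis[OF concise_low_partial[OF f] u_inj u_ind])
  then obtain M :: "'k ^ 'n option ^ 'n option" where M: "invertible M"
    "\<And>j. u j = (\<Sum>k\<in>UNIV. scale (M $ j $ k) (low_partial f k))" by auto
  have u_eval: "with_coord0 1 (\<lambda>i. total_grad f as x (e i)) $ j = eval_at x (u j)" for x j
    using e_lt by (cases j) (simp_all add: with_coord0_def total_grad_def u_def)
  have h_eval: "with_coord0 (eval_at x f) (grad f x) $ k = eval_at x (low_partial f k)" for x k
    by (cases k) (simp_all add: with_coord0_def grad_def low_partial_simps)
  have "with_coord0 1 (\<lambda>i. total_grad f as x (e i)) = M *v with_coord0 (eval_at x f) (grad f x)" for x
    by (simp add: vec_eq_iff u_eval matrix_vector_mult_def h_eval M(2) eval_at_sum eval_at_scale)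
  then show ?thesis using e M(1) unfolding equal_up_to_coord_change_def by blast
qed

theorem theorem1p16:
  fixes f :: "('n::finite, 'k::{alg_closed_field, field_char_0}) mpoly"
    and l :: nat
  assumes "concise f"
    and "l = dim_Ap f"
  shows "(\<exists>as. total_grad_indices f as) \<and>
    (\<forall>as. total_grad_indices f as \<longrightarrow>
      (maximal_growth f \<longleftrightarrow> dominant (l - 1) (total_grad f as)) \<and>
      (maximal_growth f \<longleftrightarrow> hom_alg_independent (partials f)) \<and>
      (maximal_growth f \<longleftrightarrow> encompassing f) \<and>
      (maximal_growth f \<longrightarrow>
        l = CARD('n) + 1 \<and>
        (\<exists>e :: 'n \<Rightarrow> nat. bij_betw e UNIV {..<l - 1} \<and>
          equal_up_to_coord_change
            (\<lambda>x. with_coord0 1 (\<lambda>i. total_grad f as x (e i)))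
            (\<lambda>x. with_coord0 (eval_at x f) (grad f x)))))"
proof -
  have l: "l = mp.dim (partials f)"
    using concise_dim_Ap_power[OF assms(1), of 1] assms(2) by simp
  have main: "(maximal_growth f \<longleftrightarrow> dominant (l - 1) (total_grad f as)) \<and>
      (maximal_growth f \<longleftrightarrow> hom_alg_independent (partials f)) \<and>
      (maximal_growth f \<longleftrightarrow> encompassing f) \<and>
      (maximal_growth f \<longrightarrow>
        l = CARD('n) + 1 \<and>
        (\<exists>e :: 'n \<Rightarrow> nat. bij_betw e UNIV {..<l - 1} \<and>
          equal_up_to_coord_change
            (\<lambda>x. with_coord0 1 (\<lambda>i. total_grad f as x (e i)))
            (\<lambda>x. with_coord0 (eval_at x f) (grad f x))))"
    if as: "total_grad_indices f as" for as
  proof -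
    have len: "l - 1 = length as" using as assms(2) by (simp add: total_grad_indices_def)
    \<comment> \<open>This equation links growth to encompassing and supplies the dimension needed
      for the change of coordinates.\<close>
    have growth: "maximal_growth f \<longleftrightarrow> l = CARD('n) + 1"
      unfolding l maximal_growth_iff_dim_pow_space[OF assms(1)] by (rule dim_pow_space_iff_dim_eq[OF assms(1)])
    have "maximal_growth f \<longleftrightarrow> dominant (l - 1) (total_grad f as)"
      unfolding len maximal_growth_iff_dim_pow_space[OF assms(1)]
        dominant_total_grad_iff_dim_pow_space[OF assms(1) as] ..
    moreover have "maximal_growth f \<longleftrightarrow> hom_alg_independent (partials f)"
      unfolding maximal_growth_iff_dim_pow_space[OF assms(1)]
        hom_alg_independent_partials_iff[OF assms(1)] ..
    moreover have "maximal_growth f \<longleftrightarrow> encompassing f"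
      unfolding growth l by (rule dim_eq_iff_encompassing[OF assms(1)])
    moreover have "\<exists>e :: 'n \<Rightarrow> nat. bij_betw e UNIV {..<l - 1} \<and>
          equal_up_to_coord_change
            (\<lambda>x. with_coord0 1 (\<lambda>i. total_grad f as x (e i)))
            (\<lambda>x. with_coord0 (eval_at x f) (grad f x))" if "maximal_growth f"
      unfolding len using that growth l by (intro total_grad_coord_change[OF assms(1) as]) simp
    ultimately show ?thesis using growth by blast
  qed
  show ?thesis using ex_total_grad_indices[OF assms(1)] main by blast
qed

end
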